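(* Let $n,a,b\ge0$ be integers and suppose the elbow region $E_n^{a,b}$ (defined in the context) admits at least one domino tiling. Then $$\mathrm{M}(E_n^{a,b})=2^{n(n+1)/2}\,n!\,\frac{\mathrm{H}(2n+1)\,\mathrm{H}(a)\,\mathrm{H}(b)}{\mathrm{H}(n+a+1)\,\mathrm{H}(n+b+1)}.$$
   Context: Identify the unit square $[x,x+1]\times[y,y+1]$ ($x,y\in\mathbb Z$) of the square lattice with the pair $(s,t)=(x+y,\,y-x)$; unit squares correspond bijectively to pairs $(s,t)\in\mathbb Z^2$ with $s\equiv t\pmod 2$, and two squares share an edge iff their pairs differ by $(\pm1,\pm1)$. A domino tiling of a finite set $R$ of unit squares is a partition of $R$ into pairs of edge-adjacent squares; $\mathrm{M}(R)$ is the number of domino tilings. For $k\ge0$, $\mathrm{H}(k)=0!\,1!\cdots(k-1)!$ (with $\mathrm{H}(0)=1$). The elbow region is $E_n^{a,b}=\{(s,t): s\equiv t \pmod 2,\ s+t\ge 2n+2,\ \text{and either } (0\le t\le 2n,\ s\le 2n+1+2b) \text{ or } (0\le s\le 2n,\ 2n+1\le t\le 2n+1+2a)\}.$ Geometrically, it is the part of the cruciform region $C_{n,n}^{a,b,b,a-1}$ (the union of the horizontal bar $\{s\equiv t,\ -1-2(a-1)\le s\le 2n+1+2b,\ 0\le t\le 2n\}$ and the vertical arms $\{s\equiv t,\ 0\le s\le 2n,\ -1-2b\le t\le -1 \text{ or } 2n+1\le t\le 2n+1+2a\}$) lying strictly above its horizontal row of unit squares $\{y=n\}$ (i.e. $s+t=2n$)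 joining its western and eastern outer corners. It is balanced (equal numbers of squares of each chessboard color) iff $a+b=n$. *)

theory Defs
  imports Complex_Main
begin

text \<open>Unit squares are encoded by pairs (s,t) of integers with s and t of equal parity.\<close>

definition is_square :: "int \<times> int \<Rightarrow> bool" where
  "is_square p \<longleftrightarrow> even (fst p - snd p)"

text \<open>Two squares share an edge iff their pairs differ by (+-1,+-1).\<close>
definition adjacent :: "int \<times> int \<Rightarrow> int \<times> int \<Rightarrow> bool" where
  "adjacent p q \<longleftrightarrow> \<bar>fst p - fst q\<bar> = 1 \<and> \<bar>snd p - snd q\<bar> = 1"

definition domino_tiling :: "(int \<times> int) set \<Rightarrow> (int \<times> int) set set \<Rightarrow> bool" where
  "domino_tiling R T \<longleftrightarrow>
     (\<forall>d\<in>T. \<exists>p q. d = {p, q} \<and> adjacent p q) \<and>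
     (\<forall>d\<in>T. \<forall>e\<in>T. d \<noteq> e \<longrightarrow> d \<inter> e = {}) \<and>
     \<Union>T = R"

definition M :: "(int \<times> int) set \<Rightarrow> nat" where
  "M R = card {T. domino_tiling R T}"

definition H :: "nat \<Rightarrow> nat" where
  "H k = (\<Prod>i<k. fact i)"

definition elbow :: "nat \<Rightarrow> nat \<Rightarrow> nat \<Rightarrow> (int \<times> int) set" where
  "elbow n a b = {(s, t). even (s - t) \<and> s + t \<ge> 2 * int n + 2 \<and>
      ((0 \<le> t \<and> t \<le> 2 * int n \<and> s \<le> 2 * int n + 1 + 2 * int b) \<or>
       (0 \<le> s \<and> s \<le> 2 * int n \<and> 2 * int n + 1 \<le> t \<and> t \<le> 2 * int n + 1 + 2 * int a))}"

end

theory Submission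
  imports Defs "Jordan_Normal_Form.Determinant" "HOL-Computational_Algebra.Polynomial_FPS"
begin

text \<open>
  Write even squares as (2i, 2j) and odd squares as (2i + 1, 2j + 1), and build the region column by
  column. If the even squares used by a later odd column form the set p, the number of tilings of what
  lies to the left is a determinant det (f k i (p j)), where the functions f k satisfy the local rule
  f (i + 1, j) - f (i + 1, j + 1) = f (i, j) + f (i, j + 1), vanish on the antidiagonal i + j = n
  and vanish above the top arm. In the right arm one new function, constant 1, enters per even column.

  Solutions of the local rule are f (i, j) = L ((1 + x)^i x^j (2 + x)^(n - j)) for linear functionals L on
  power series, and vanishing on the antidiagonal is antisymmetry of L under x \<rightarrow> 2 / x.
  The functionals L are chosen such that the determinant is triangular both at the left end of the
  region and, after taking differences and sums of neighbouring columns, at the right end.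
  In the pairing (u - w)^(2n) of binary forms of degree 2n, the k-th of these functionals is the form
  (w - 1)^(n - k) (w (w + 1))^(k - 1) (w^2 - 2 w - 1), where u = 1 + x; its orders of vanishing at
  w = 0, 1, -1, \<infinity> give all the required zeros.
\<close>

section \<open>Adding a square to a region\<close>

lemma adjacent_sym: "adjacent p q \<longleftrightarrow> adjacent q p"
  by (auto simp: adjacent_def abs_minus_commute)

lemma adjacent_irrefl [simp]: "\<not> adjacent p p"
  by (auto simp: adjacent_def)

lemma finite_tilings:
  assumes "finite R"
  shows "finite {T. domino_tiling R T}"
proof (rule finite_subset)
  show "{T. domino_tiling R T} \<subseteq> Pow (Pow R)"
    by (auto simp: domino_tiling_def)
qed (use assms in auto)

lemma M_empty [simp]: "M {} = 1"
proof -
  have "{T. domino_tiling {} T} = {{}}"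
  proof (intro equalityI subsetI)
    fix T assume "T \<in> {T. domino_tiling {} T}"
    hence "domino_tiling {} T" by simp
    hence ne: "d \<noteq> {}" if "d \<in> T" for d using that by (auto simp: domino_tiling_def)
    have "\<Union>T = {}" using \<open>domino_tiling {} T\<close> by (simp add: domino_tiling_def)
    with ne show "T \<in> {{}}" by blast
  qed (auto simp: domino_tiling_def)
  thus ?thesis by (simp add: M_def)
qed

lemma domino_tilingI:
  assumes "\<And>d. d \<in> T \<Longrightarrow> \<exists>p q. d = {p, q} \<and> adjacent p q"
    and "\<And>d e. d \<in> T \<Longrightarrow> e \<in> T \<Longrightarrow> d \<noteq> e \<Longrightarrow> d \<inter> e = {}"
    and "\<Union>T = R"
  shows "domino_tiling R T"
  using assms unfolding domino_tiling_def by simp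

lemma domino_tilingD:
  assumes "domino_tiling R T"
  shows "d \<in> T \<Longrightarrow> \<exists>p q. d = {p, q} \<and> adjacent p q"
    and "d \<in> T \<Longrightarrow> e \<in> T \<Longrightarrow> d \<noteq> e \<Longrightarrow> d \<inter> e = {}"
    and "\<Union>T = R"
  using assms unfolding domino_tiling_def by simp_all

lemma domino_tiling_add:
  assumes T: "domino_tiling (R - {w}) T" and w: "w \<in> R" "y \<notin> R" "adjacent y w"
  shows "domino_tiling (insert y R) (insert {y, w} T)"
proof (rule domino_tilingI)
  note U = domino_tilingD(3)[OF T]
  have disj: "{y, w} \<inter> e = {}" if "e \<in> T" for e using U w that by blast
  show "\<Union>(insert {y, w} T) = insert y R" using U w by auto
  fix d assume d: "d \<in> insert {y, w} T"
  show "\<exists>p q. d = {p, q} \<and> adjacent p q"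
  proof (cases "d \<in> T")
    case True thus ?thesis using domino_tilingD(1)[OF T] by simp
  next
    case False
    hence "d = {y, w}" using d by simp
    thus ?thesis using w by blast
  qed
  fix e assume e: "e \<in> insert {y, w} T" and "d \<noteq> e"
  then consider "d = {y, w}" "e \<in> T" | "e = {y, w}" "d \<in> T" | "d \<in> T" "e \<in> T"
    using d by blast
  thus "d \<inter> e = {}"
  proof cases
    case 1 thus ?thesis using disj by simp
  next
    case 2 thus ?thesis using disj by (simp add: Int_commute)
  next
    case 3 thus ?thesis using domino_tilingD(2)[OF T] \<open>d \<noteq> e\<close> by simp
  qed
qed

lemma domino_tiling_remove:
  assumes T: "domino_tiling R T" and d: "d \<in> T"
  shows "domino_tiling (R - d) (T - {d})"
proof (rule domino_tilingI)
  have "\<Union>(T - {d}) = \<Union>T - d"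
    using domino_tilingD(2)[OF T] d by blast
  thus "\<Union>(T - {d}) = R - d" by (simp add: domino_tilingD(3)[OF T])
qed (use domino_tilingD(1,2)[OF T] in simp_all)

text \<open>Sorts the tilings by the partner \<open>w\<close> of \<open>y\<close>; deleting the
  domino \<open>{y, w}\<close> is a bijection onto the tilings of \<open>R - {w}\<close>. All later
  counting peels off squares by this recurrence.\<close>

lemma M_insert:
  assumes fin: "finite R" and y: "y \<notin> R"
  shows "M (insert y R) = (\<Sum>w\<in>{w\<in>R. adjacent y w}. M (R - {w}))"
proof -
  let ?W = "{w\<in>R. adjacent y w}"
  let ?A = "\<lambda>w. insert {y, w} ` {T. domino_tiling (R - {w}) T}"
  \<comment> \<open>No tiling of a subset of \<open>R\<close> covers \<open>y\<close>. This gives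
    both the disjointness of the classes for different \<open>w\<close> and the injectivity of
    inserting the new domino.\<close>
  have notin: "{y, w} \<notin> T" if "domino_tiling (R - {v}) T" for v w T
    using domino_tilingD(3)[OF that] y by blast
  have eq: "{T. domino_tiling (insert y R) T} = (\<Union>w\<in>?W. ?A w)"
  proof (intro equalityI subsetI)
    fix T assume "T \<in> {T. domino_tiling (insert y R) T}"
    hence T: "domino_tiling (insert y R) T" by simp
    hence "y \<in> \<Union>T" by (simp add: domino_tiling_def)
    then obtain d where d: "d \<in> T" "y \<in> d" by blast
    then obtain p q where pq: "d = {p, q}" "adjacent p q"
      using domino_tilingD(1)[OF T] by blast
    obtain w where w: "d = {y, w}" "adjacent y w"
    proof (cases "y = p")
      case True thus ?thesis using pq that by auto
    next
      case False
      hence "y = q" using pq d by auto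
      thus ?thesis using pq that[of p] by (auto simp: adjacent_sym insert_commute)
    qed
    have "w \<in> insert y R" using domino_tilingD(3)[OF T] d w by blast
    hence wR: "w \<in> R" using w by auto
    have "domino_tiling (insert y R - {y, w}) (T - {{y, w}})"
      using domino_tiling_remove[OF T d(1)] by (simp only: w(1))
    moreover have "insert y R - {y, w} = R - {w}" using y by auto
    ultimately have "T - {{y, w}} \<in> {T. domino_tiling (R - {w}) T}" by simp
    moreover have "T = insert {y, w} (T - {{y, w}})" using d w by auto
    ultimately have "T \<in> ?A w" by blast
    thus "T \<in> (\<Union>w\<in>?W. ?A w)" using w wR by blast
  next
    fix T assume "T \<in> (\<Union>w\<in>?W. ?A w)"
    thus "T \<in> {T. domino_tiling (insert y R) T}"
      by (auto simp del: split_paired_All split_paired_Ex intro: domino_tiling_add[OF _ _ y])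
  qed
  have disj: "?A v \<inter> ?A w = {}" if "v \<in> ?W" "w \<in> ?W" "v \<noteq> w" for v w
  proof -
    have ne: "{y, v} \<noteq> {y, w}" using that by (auto simp: doubleton_eq_iff)
    {
      fix S T assume "domino_tiling (R - {v}) S" "domino_tiling (R - {w}) T"
        "insert {y, v} S = insert {y, w} T"
      hence False using notin[of w T v] ne by blast
    }
    thus ?thesis by blast
  qed
  have card: "card (?A w) = M (R - {w})" for w
    unfolding M_def
  proof (rule card_image, rule inj_onI)
    fix S T assume "S \<in> {T. domino_tiling (R - {w}) T}" "T \<in> {T. domino_tiling (R - {w}) T}"
      "insert {y, w} S = insert {y, w} T"
    thus "S = T" using notin[of w] by (metis insert_ident mem_Collect_eq)
  qed
  have "M (insert y R) = card (\<Union>w\<in>?W. ?A w)" by (simp add: M_def eq)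
  also have "\<dots> = (\<Sum>w\<in>?W. card (?A w))"
    by (intro card_UN_disjoint) (use fin disj in \<open>auto intro!: finite_tilings\<close>)
  finally show ?thesis by (simp add: card)
qed

section \<open>Even and odd squares with halved coordinates\<close>

definition esq :: "nat \<Rightarrow> nat \<Rightarrow> int \<times> int" where
  "esq i j = (2 * int i, 2 * int j)"

definition osq :: "nat \<Rightarrow> nat \<Rightarrow> int \<times> int" where
  "osq i j = (2 * int i + 1, 2 * int j + 1)"

lemma esq_eq_iff [simp]: "esq i j = esq i' j' \<longleftrightarrow> i = i' \<and> j = j'"
  by (auto simp: esq_def)

lemma osq_eq_iff [simp]: "osq i j = osq i' j' \<longleftrightarrow> i = i' \<and> j = j'"
  by (auto simp: osq_def)

lemma esq_neq_osq [simp]: "esq i j \<noteq> osq i' j'" "osq i' j' \<noteq> esq i j"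
  unfolding esq_def osq_def by (simp_all, presburger+)

lemma not_adjacent_esq_esq [simp]: "\<not> adjacent (esq i j) (esq i' j')"
  unfolding adjacent_def esq_def by (simp, presburger)

lemma not_adjacent_osq_osq [simp]: "\<not> adjacent (osq i j) (osq i' j')"
  unfolding adjacent_def osq_def by (simp, presburger)

lemma adjacent_osq_esq [simp]:
  "adjacent (osq i j) (esq i' j') \<longleftrightarrow> i' \<in> {i, Suc i} \<and> j' \<in> {j, Suc j}"
  unfolding adjacent_def esq_def osq_def by (simp, presburger)

lemma adjacent_esq_osq [simp]:
  "adjacent (esq i j) (osq i' j') \<longleftrightarrow> i \<in> {i', Suc i'} \<and> j \<in> {j', Suc j'}"
  by (subst adjacent_sym) (rule adjacent_osq_esq)

text \<open>Natural indices restrict attention to nonnegative coordinates, which suffices for the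
  elbow, and turn adjacency into index arithmetic.\<close>

definition squares_region :: "(int \<times> int) set \<Rightarrow> bool" where
  "squares_region R \<longleftrightarrow> finite R \<and> R \<subseteq> range (case_prod esq) \<union> range (case_prod osq)"

lemma esq_in_range [simp]: "esq i j \<in> range (case_prod esq)"
  by (rule range_eqI[of _ _ "(i, j)"]) simp

lemma osq_in_range [simp]: "osq i j \<in> range (case_prod osq)"
  by (rule range_eqI[of _ _ "(i, j)"]) simp

lemma squares_regionD:
  assumes "squares_region R" "x \<in> R"
  obtains i j where "x = esq i j" | i j where "x = osq i j"
  using assms unfolding squares_region_def by auto

lemma squares_region_finite: "squares_region R \<Longrightarrow> finite R"
  by (simp add: squares_region_def)

lemma squares_region_empty [intro!, simp]: "squares_region {}"
  by (simp add: squares_region_def)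

lemma squares_region_Un [simp]: "squares_region (R \<union> S) \<longleftrightarrow> squares_region R \<and> squares_region S"
  by (auto simp: squares_region_def)

lemma squares_region_insert_osq [simp]: "squares_region (insert (osq i j) R) \<longleftrightarrow> squares_region R"
  by (auto simp: squares_region_def)

lemma squares_region_esq [simp]: "squares_region (esq i ` J) \<longleftrightarrow> finite J"
  by (auto simp: squares_region_def finite_image_iff inj_on_def simp del: split_paired_All)

lemma squares_region_osq [simp]: "squares_region (osq i ` J) \<longleftrightarrow> finite J"
  by (auto simp: squares_region_def finite_image_iff inj_on_def simp del: split_paired_All)

text \<open>With no even squares in column \<open>Suc i\<close>, the new odd square can only be
  matched to the left, where it has two neighbours.\<close>

lemma M_insert_osq:
  assumes R: "squares_region R" and q: "osq i q \<notin> R" and nxt: "\<forall>j. esq (Suc i) j \<notin> R"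
  shows "M (insert (osq i q) R) = (\<Sum>w\<in>{w\<in>{q, Suc q}. esq i w \<in> R}. M (R - {esq i w}))"
proof -
  have "{w\<in>R. adjacent (osq i q) w} = esq i ` {w\<in>{q, Suc q}. esq i w \<in> R}"
  proof (intro equalityI subsetI)
    fix x assume x: "x \<in> {w\<in>R. adjacent (osq i q) w}"
    with R show "x \<in> esq i ` {w\<in>{q, Suc q}. esq i w \<in> R}"
      by (auto elim!: squares_regionD[of R x] simp: nxt)
  qed auto
  thus ?thesis
    using M_insert[OF squares_region_finite[OF R] q] by (simp add: sum.reindex inj_on_def)
qed

text \<open>The form \<open>Suc w = x\<close>, instead of \<open>w = x - 1\<close>, ensures that
  there is no lower neighbour when \<open>x = 0\<close>.\<close>

lemma M_insert_esq:
  assumes R: "squares_region R" and q: "esq (Suc i) x \<notin> R" and nxt: "\<forall>j. osq (Suc i) j \<notin> R"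
  shows "M (insert (esq (Suc i) x) R) =
    (\<Sum>w\<in>{w. (w = x \<or> Suc w = x) \<and> osq i w \<in> R}. M (R - {osq i w}))"
proof -
  have "{w\<in>R. adjacent (esq (Suc i) x) w} = osq i ` {w. (w = x \<or> Suc w = x) \<and> osq i w \<in> R}"
  proof (intro equalityI subsetI)
    fix y assume y: "y \<in> {w\<in>R. adjacent (esq (Suc i) x) w}"
    with R show "y \<in> osq i ` {w. (w = x \<or> Suc w = x) \<and> osq i w \<in> R}"
      by (auto elim!: squares_regionD[of R y] simp: nxt)
  qed auto
  thus ?thesis
    using M_insert[OF squares_region_finite[OF R] q] by (simp add: sum.reindex inj_on_def)
qed

section \<open>Forced dominoes and segments of a column\<close>

text \<open>The highest even square has no odd neighbour above it, so its domino points down;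
  removing this domino gives the same situation one step lower.\<close>

lemma M_forced_down:
  assumes R: "squares_region R" and nxt: "\<forall>j. osq (Suc i) j \<notin> R"
    and free: "\<forall>j\<in>{l..h}. osq i j \<notin> R" "\<forall>j\<in>{l<..h}. esq (Suc i) j \<notin> R" and "l \<le> h"
  shows "M (R \<union> osq i ` {l..<h} \<union> esq (Suc i) ` {l<..h}) = M R"
  using \<open>l \<le> h\<close> free
proof (induction h rule: dec_induct)
  case base
  thus ?case by simp
next
  case (step h)
  let ?S = "R \<union> osq i ` {l..<Suc h} \<union> esq (Suc i) ` {l<..h}"
  have eq: "R \<union> osq i ` {l..<Suc h} \<union> esq (Suc i) ` {l<..Suc h} = insert (esq (Suc i) (Suc h)) ?S"
    using step by (auto simp: le_Suc_eq)
  have W: "{w. (w = Suc h \<or> Suc w = Suc h) \<and> osq i w \<in> ?S} = {h}"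
    using step by (auto simp: image_iff)
  have D: "?S - {osq i h} = R \<union> osq i ` {l..<h} \<union> esq (Suc i) ` {l<..h}"
    using step by (auto simp: image_iff less_Suc_eq)
  have "M (insert (esq (Suc i) (Suc h)) ?S) = M (?S - {osq i h})"
    by (subst M_insert_esq) (use R nxt step W in \<open>auto simp: image_iff\<close>)
  also have "\<dots> = M R" unfolding D by (rule step.IH) (use step in auto)
  finally show ?case by (simp only: eq)
qed

text \<open>The mirror case, peeled from the bottom: the lowest even square has no odd neighbour
  below it, so even and odd squares of equal index are paired.\<close>

lemma M_forced_up:
  assumes R: "squares_region R" and nxt: "\<forall>j. osq (Suc i) j \<notin> R"
    and free: "\<forall>j\<in>{l..<h}. osq i j \<notin> R \<and> esq (Suc i) j \<notin> R" "\<forall>j. Suc j = l \<longrightarrow> osq i j \<notin> R"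
    and "l \<le> h"
  shows "M (R \<union> osq i ` {l..<h} \<union> esq (Suc i) ` {l..<h}) = M R"
  using \<open>l \<le> h\<close> free
proof (induction l rule: inc_induct)
  case base
  thus ?case by simp
next
  case (step l)
  let ?S = "R \<union> osq i ` {l..<h} \<union> esq (Suc i) ` {Suc l..<h}"
  have eq: "R \<union> osq i ` {l..<h} \<union> esq (Suc i) ` {l..<h} = insert (esq (Suc i) l) ?S"
    using step by (auto simp: image_iff le_eq_less_or_eq Suc_le_eq)
  have W: "{w. (w = l \<or> Suc w = l) \<and> osq i w \<in> ?S} = {l}"
    using step by (auto simp: image_iff)
  have D: "?S - {osq i l} = R \<union> osq i ` {Suc l..<h} \<union> esq (Suc i) ` {Suc l..<h}"
    using step by (auto simp: image_iff Suc_le_eq)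
  have "M (insert (esq (Suc i) l) ?S) = M (?S - {osq i l})"
    by (subst M_insert_esq) (use R nxt step W in \<open>auto simp: image_iff\<close>)
  also have "\<dots> = M R" unfolding D by (rule step.IH) (use step in auto)
  finally show ?case by (simp only: eq)
qed

text \<open>In a segment of odd squares, the even squares strictly in between leave exactly one odd square
  free for the previous column, in exactly one way for each choice of that square.\<close>

lemma M_segment:
  assumes R: "squares_region R" and nxt: "\<forall>j. osq (Suc i) j \<notin> R"
    and free: "\<forall>j\<in>{l..<h}. osq i j \<notin> R" "\<forall>j\<in>{l<..<h}. esq (Suc i) j \<notin> R" and "l < h"
  shows "M (R \<union> osq i ` {l..<h} \<union> esq (Suc i) ` {l<..<h}) = (\<Sum>x\<in>{l..<h}. M (insert (osq i x) R))"
proof -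
  from \<open>l < h\<close> have "Suc l \<le> h" by simp
  thus ?thesis using free
  proof (induction h rule: dec_induct)
    case base
    have "{l<..<Suc l} = {}" "{l..<Suc l} = {l}" by auto
    thus ?case by simp
  next
    case (step h)
    let ?S = "R \<union> osq i ` {l..<Suc h} \<union> esq (Suc i) ` {l<..<h}"
    obtain h' where h': "h = Suc h'" "l \<le> h'" using step by (cases h) auto
    have eq: "R \<union> osq i ` {l..<Suc h} \<union> esq (Suc i) ` {l<..<Suc h} = insert (esq (Suc i) h) ?S"
      using step by (auto simp: less_Suc_eq)
    have W: "{w. (w = h \<or> Suc w = h) \<and> osq i w \<in> ?S} = {h', h}"
      using step h' by (auto simp: image_iff)
    have D1: "?S - {osq i h} = R \<union> osq i ` {l..<h} \<union> esq (Suc i) ` {l<..<h}"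
      using step by (auto simp: image_iff less_Suc_eq)
    have D2: "?S - {osq i h'} = insert (osq i h) R \<union> osq i ` {l..<h'} \<union> esq (Suc i) ` {l<..h'}"
      using step h' by (auto simp: image_iff less_Suc_eq)
    \<comment> \<open>The last even square takes either \<open>osq i h\<close>, which leaves a
      shorter segment, or the square \<open>osq i h'\<close> below it, which leaves
      \<open>osq i h\<close> free and forces all dominoes further down.\<close>
    have "M (insert (esq (Suc i) h) ?S) = M (?S - {osq i h'}) + M (?S - {osq i h})"
      by (subst M_insert_esq) (use R nxt step W h' in \<open>auto simp: image_iff\<close>)
    also have "M (?S - {osq i h'}) = M (insert (osq i h) R)"
      unfolding D2 by (rule M_forced_down) (use R nxt step h' in auto)
    also have "M (?S - {osq i h}) = (\<Sum>x\<in>{l..<h}. M (insert (osq i x) R))"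
      unfolding D1 by (rule step.IH) (use step in auto)
    finally show ?case using step unfolding eq by (simp add: atLeastLessThanSuc)
  qed
qed

section \<open>Adding a column\<close>

lemma sum_PiE_Suc:
  fixes B :: "nat \<Rightarrow> 'b set"
  shows "(\<Sum>q\<in>PiE {..<Suc m} B. f q) = (\<Sum>x\<in>B m. \<Sum>q\<in>PiE {..<m} B. f (q(m := x)))"
proof -
  have inj: "inj_on (\<lambda>(y, g). g(m := y)) (B m \<times> PiE {..<m} B)"
    by (rule inj_combinator) simp
  have "(\<Sum>q\<in>PiE {..<Suc m} B. f q) = (\<Sum>(y, g)\<in>B m \<times> PiE {..<m} B. f (g(m := y)))"
    unfolding lessThan_Suc PiE_insert_eq
    by (subst sum.reindex[OF inj]) (simp add: case_prod_unfold o_def)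
  thus ?thesis by (simp add: sum.cartesian_product)
qed

text \<open>The even positions \<open>P j\<close> reserved for the next column cut this one into
  independent segments, so the surviving odd squares \<open>q j\<close> interlace with the
  \<open>P j\<close>. The value \<open>P m\<close> is only the upper end of the last
  segment.\<close>

lemma M_segments:
  assumes "squares_region R" "\<forall>j. osq (Suc i) j \<notin> R" "\<forall>j. esq (Suc i) j \<notin> R"
    and "\<forall>j\<in>{P 0..<P m}. osq i j \<notin> R" and "\<forall>j<m. P j < P (Suc j)"
  shows "M (R \<union> osq i ` {P 0..<P m} \<union> esq (Suc i) ` ({P 0..<P m} - P ` {..<m})) =
    (\<Sum>q\<in>PiE {..<m} (\<lambda>j. {P j..<P (Suc j)}). M (R \<union> osq i ` q ` {..<m}))"
  using assms
proof (induction m arbitrary: R)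
  case 0
  thus ?case by simp
next
  case (Suc m)
  have below: "P j < P m" if "j < m" for j
    using that Suc.prems(5)
  proof (induction m)
    case (Suc m) thus ?case by (cases "j = m") (auto intro: less_trans)
  qed simp
  have lt: "P m < P (Suc m)" using Suc.prems(5) by simp
  have le: "P 0 \<le> P m" using below[of 0] by (cases m) auto
  let ?R = "R \<union> osq i ` {P 0..<P m} \<union> esq (Suc i) ` ({P 0..<P m} - P ` {..<m})"
  have eq: "R \<union> osq i ` {P 0..<P (Suc m)} \<union> esq (Suc i) ` ({P 0..<P (Suc m)} - P ` {..<Suc m})
    = ?R \<union> osq i ` {P m..<P (Suc m)} \<union> esq (Suc i) ` {P m<..<P (Suc m)}"
  proof -
    have 1: "{P 0..<P (Suc m)} = {P 0..<P m} \<union> {P m..<P (Suc m)}" using le lt by auto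
    have 2: "{P 0..<P (Suc m)} - P ` {..<Suc m} = ({P 0..<P m} - P ` {..<m}) \<union> {P m<..<P (Suc m)}"
      using le lt below by (force simp: lessThan_Suc)
    show ?thesis unfolding 2 unfolding 1 by (simp add: image_Un Un_ac)
  qed
  have "M (?R \<union> osq i ` {P m..<P (Suc m)} \<union> esq (Suc i) ` {P m<..<P (Suc m)}) =
     (\<Sum>x\<in>{P m..<P (Suc m)}. M (insert (osq i x) ?R))"
    by (rule M_segment) (use Suc.prems lt le in auto)
  also have "\<dots> = (\<Sum>x\<in>{P m..<P (Suc m)}. \<Sum>q\<in>PiE {..<m} (\<lambda>j. {P j..<P (Suc j)}).
      M (insert (osq i x) R \<union> osq i ` q ` {..<m}))"
  proof (rule sum.cong[OF refl])
    fix x assume x: "x \<in> {P m..<P (Suc m)}"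
    have "M (insert (osq i x) R \<union> osq i ` {P 0..<P m} \<union> esq (Suc i) ` ({P 0..<P m} - P ` {..<m})) =
      (\<Sum>q\<in>PiE {..<m} (\<lambda>j. {P j..<P (Suc j)}). M (insert (osq i x) R \<union> osq i ` q ` {..<m}))"
      by (rule Suc.IH) (use Suc.prems x lt in auto)
    thus "M (insert (osq i x) ?R) = 
      (\<Sum>q\<in>PiE {..<m} (\<lambda>j. {P j..<P (Suc j)}). M (insert (osq i x) R \<union> osq i ` q ` {..<m}))"
      by simp
  qed
  also have "\<dots> = (\<Sum>q\<in>PiE {..<Suc m} (\<lambda>j. {P j..<P (Suc j)}). M (R \<union> osq i ` q ` {..<Suc m}))"
    unfolding sum_PiE_Suc
    by (intro sum.cong refl arg_cong[of _ _ M]) (auto simp: lessThan_Suc)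
  finally show ?case unfolding eq .
qed

text \<open>Colliding or forbidden choices are kept as zero terms, so that the index set is a full
  product and multilinearity of determinants can be applied to the sum.\<close>

lemma M_hop:
  fixes q :: "nat \<Rightarrow> nat"
  assumes "squares_region R" "\<forall>j. esq (Suc i) j \<notin> R" "\<forall>j. osq i j \<notin> R" "\<forall>j. esq i j \<notin> R"
    and "finite J" and "inj_on q {..<m}"
  shows "M (R \<union> esq i ` J \<union> osq i ` q ` {..<m}) =
    (\<Sum>h\<in>PiE {..<m} (\<lambda>j. {q j, Suc (q j)}).
      if inj_on h {..<m} \<and> h ` {..<m} \<subseteq> J then M (R \<union> esq i ` (J - h ` {..<m})) else 0)"
  using assms(5,6)
proof (induction m arbitrary: J)
  case 0
  thus ?case by simp
next
  case (Suc m)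
  let ?S = "R \<union> esq i ` J \<union> osq i ` q ` {..<m}"
  let ?B = "\<lambda>j. {q j, Suc (q j)}"
  have qm: "q m \<notin> q ` {..<m}"
  proof
    assume "q m \<in> q ` {..<m}"
    then obtain j where "j < m" "q m = q j" by auto
    with inj_onD[OF Suc.prems(2), of m j] show False by simp
  qed
  have inj: "inj_on q {..<m}" using Suc.prems(2) by (rule inj_on_subset) auto
  have eq: "R \<union> esq i ` J \<union> osq i ` q ` {..<Suc m} = insert (osq i (q m)) ?S"
    by (auto simp: lessThan_Suc)
  have "M (insert (osq i (q m)) ?S) = (\<Sum>w\<in>{w\<in>?B m. esq i w \<in> ?S}. M (?S - {esq i w}))"
    by (rule M_insert_osq) (use assms Suc.prems qm in \<open>auto simp: image_iff\<close>)
  also have "{w\<in>?B m. esq i w \<in> ?S} = {w\<in>?B m. w \<in> J}"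
    using assms(4) by (auto simp: image_iff)
  also have "(\<Sum>w\<in>{w\<in>?B m. w \<in> J}. M (?S - {esq i w})) = (\<Sum>w\<in>?B m. if w \<in> J then M (?S - {esq i w}) else 0)"
    by (rule sum.inter_filter) simp
  also have "\<dots> = (\<Sum>w\<in>?B m. \<Sum>h\<in>PiE {..<m} ?B.
      if inj_on (h(m := w)) {..<Suc m} \<and> (h(m := w)) ` {..<Suc m} \<subseteq> J
      then M (R \<union> esq i ` (J - (h(m := w)) ` {..<Suc m})) else 0)"
  proof (rule sum.cong[OF refl])
    fix w assume w: "w \<in> ?B m"
    have inj': "inj_on (h(m := w)) {..<Suc m} \<longleftrightarrow> inj_on h {..<m} \<and> w \<notin> h ` {..<m}" for h :: "nat \<Rightarrow> nat"
    proof -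
      have "inj_on (h(m := w)) {..<m} \<longleftrightarrow> inj_on h {..<m}" by (rule inj_on_cong) auto
      moreover have "(h(m := w)) ` {..<m} = h ` {..<m}" by auto
      ultimately show ?thesis by (auto simp: lessThan_Suc)
    qed
    have img: "(h(m := w)) ` {..<Suc m} = insert w (h ` {..<m})" for h :: "nat \<Rightarrow> nat"
      by (auto simp: lessThan_Suc)
    show "(if w \<in> J then M (?S - {esq i w}) else 0) = (\<Sum>h\<in>PiE {..<m} ?B.
      if inj_on (h(m := w)) {..<Suc m} \<and> (h(m := w)) ` {..<Suc m} \<subseteq> J
      then M (R \<union> esq i ` (J - (h(m := w)) ` {..<Suc m})) else 0)"
    proof (cases "w \<in> J")
      case True
      have "?S - {esq i w} = R \<union> esq i ` (J - {w}) \<union> osq i ` q ` {..<m}"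
        using assms(4) by (auto simp: image_iff)
      hence "M (?S - {esq i w}) = (\<Sum>h\<in>PiE {..<m} ?B.
        if inj_on h {..<m} \<and> h ` {..<m} \<subseteq> J - {w}
        then M (R \<union> esq i ` (J - {w} - h ` {..<m})) else 0)"
        using Suc.IH[of "J - {w}"] Suc.prems(1) inj by simp
      also have "\<dots> = (\<Sum>h\<in>PiE {..<m} ?B.
        if inj_on (h(m := w)) {..<Suc m} \<and> (h(m := w)) ` {..<Suc m} \<subseteq> J
        then M (R \<union> esq i ` (J - (h(m := w)) ` {..<Suc m})) else 0)"
        unfolding inj' img using True
        by (intro sum.cong refl if_cong arg_cong[of _ _ M] arg_cong2[of _ _ _ _ "(\<union>)"] 
            arg_cong2[of _ _ _ _ "(`)"]) auto
      finally show ?thesis using True by simp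
    next
      case False
      thus ?thesis unfolding img by simp
    qed
  qed
  also have "\<dots> = (\<Sum>h\<in>PiE {..<Suc m} ?B.
      if inj_on h {..<Suc m} \<and> h ` {..<Suc m} \<subseteq> J then M (R \<union> esq i ` (J - h ` {..<Suc m})) else 0)"
    by (rule sum_PiE_Suc[symmetric])
  finally show ?case unfolding eq .
qed

section \<open>Determinants as functions of row and column index\<close>

definition fdet :: "nat \<Rightarrow> (nat \<Rightarrow> nat \<Rightarrow> real) \<Rightarrow> real" where
  "fdet m A = det (mat m m (\<lambda>(k, j). A k j))"

lemma fdet_cong:
  assumes "\<And>k j. k < m \<Longrightarrow> j < m \<Longrightarrow> A k j = B k j"
  shows "fdet m A = fdet m B"
  unfolding fdet_def using assms by (intro arg_cong[of _ _ det] eq_matI) auto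

lemma fdet_0 [simp]: "fdet 0 A = 1"
  by (simp add: fdet_def)

text \<open>Multilinearity in the columns, obtained by expanding the products in the Leibniz
  formula.\<close>

lemma fdet_sum_columns:
  assumes "\<And>j. j < m \<Longrightarrow> finite (B j)"
  shows "fdet m (\<lambda>k j. \<Sum>x\<in>B j. g k j x) = (\<Sum>h\<in>PiE {..<m} B. fdet m (\<lambda>k j. g k j (h j)))"
proof -
  have *: "fdet m A = (\<Sum>p | p permutes {0..<m}. signof p * (\<Prod>j<m. A (p j) j))" for A
  proof -
    have "fdet m A = (\<Sum>p | p permutes {0..<m}. signof p * (\<Prod>j<m. mat m m (\<lambda>(k, j). A k j) $$ (p j, j)))"
      unfolding fdet_def by (rule det_col) simp
    also have "\<dots> = (\<Sum>p | p permutes {0..<m}. signof p * (\<Prod>j<m. A (p j) j))"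
    proof (intro sum.cong refl arg_cong2[of _ _ _ _ "(*)"] prod.cong)
      fix p j assume "p \<in> {p. p permutes {0..<m}}" "j \<in> {..<m}"
      thus "mat m m (\<lambda>(k, j). A k j) $$ (p j, j) = A (p j) j"
        using permutes_in_image[of p "{0..<m}" j] by auto
    qed
    finally show ?thesis .
  qed
  show ?thesis
    unfolding * using assms
    by (subst prod_sum_PiE) (auto simp: sum_distrib_left intro: sum.swap)
qed

lemma fdet_zero_column:
  assumes "j < m" "\<And>k. k < m \<Longrightarrow> A k j = 0"
  shows "fdet m A = 0"
proof -
  have "fdet m A = (\<Sum>k<m. mat m m (\<lambda>(k, j). A k j) $$ (k, j) * cofactor (mat m m (\<lambda>(k, j). A k j)) k j)"
    unfolding fdet_def by (rule laplace_expansion_column) (use assms in auto)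
  also have "\<dots> = 0" using assms by (intro sum.neutral) auto
  finally show ?thesis .
qed

lemma fdet_identical_columns:
  assumes "i < m" "j < m" "i \<noteq> j" "\<And>k. k < m \<Longrightarrow> A k i = A k j"
  shows "fdet m A = 0"
  unfolding fdet_def using assms by (intro det_identical_columns[of _ m i j]) auto

lemma fdet_mult: "fdet m A * fdet m B = fdet m (\<lambda>k j. \<Sum>l<m. A k l * B l j)"
proof -
  have "fdet m A * fdet m B = det (mat m m (\<lambda>(k, j). A k j) * mat m m (\<lambda>(k, j). B k j))"
    unfolding fdet_def by (rule det_mult[symmetric]) auto
  also have "mat m m (\<lambda>(k, j). A k j) * mat m m (\<lambda>(k, j). B k j) =
      mat m m (\<lambda>(k, j). \<Sum>l<m. A k l * B l j)"
    by (rule eq_matI) (auto simp: scalar_prod_def atLeast0LessThan)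
  finally show ?thesis unfolding fdet_def .
qed

lemma fdet_upper_triangular:
  assumes "\<And>k j. k < m \<Longrightarrow> j < k \<Longrightarrow> A k j = 0"
  shows "fdet m A = (\<Prod>k<m. A k k)"
proof -
  have "fdet m A = prod_list (diag_mat (mat m m (\<lambda>(k, j). A k j)))"
    unfolding fdet_def by (rule det_upper_triangular[of _ m]) (use assms in \<open>auto simp: upper_triangular_def\<close>)
  also have "\<dots> = (\<Prod>k<m. A k k)"
    by (simp add: prod_list_diag_prod atLeast0LessThan)
  finally show ?thesis .
qed

lemma fdet_lower_triangular:
  assumes "\<And>k j. j < m \<Longrightarrow> k < j \<Longrightarrow> A k j = 0"
  shows "fdet m A = (\<Prod>k<m. A k k)"
proof -
  have "fdet m A = prod_list (diag_mat (mat m m (\<lambda>(k, j). A k j)))"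
    unfolding fdet_def by (rule det_lower_triangular[of m]) (use assms in auto)
  also have "\<dots> = (\<Prod>k<m. A k k)"
    by (simp add: prod_list_diag_prod atLeast0LessThan)
  finally show ?thesis .
qed

lemma fdet_last_row:
  assumes "\<And>j. j < m \<Longrightarrow> A m j = 0"
  shows "fdet (Suc m) A = A m m * fdet m A"
proof -
  let ?X = "mat (Suc m) (Suc m) (\<lambda>(k, j). A k j)"
  have "fdet (Suc m) A = (\<Sum>j<Suc m. ?X $$ (m, j) * cofactor ?X m j)"
    unfolding fdet_def by (rule laplace_expansion_row) auto
  also have "\<dots> = A m m * cofactor ?X m m"
    using assms by simp
  also have "mat_delete ?X m m = mat m m (\<lambda>(k, j). A k j)"
    by (rule eq_matI) (auto simp: mat_delete_def)
  hence "cofactor ?X m m = fdet m A"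
    by (simp add: cofactor_def fdet_def)
  finally show ?thesis .
qed

text \<open>Right multiplication by a bidiagonal matrix with unit diagonal. It removes the
  differences that telescoping over segments produces.\<close>

lemma fdet_column_differences:
  "fdet m (\<lambda>k j. A k j - (if Suc j < m then A k (Suc j) else 0)) = fdet m A"
proof -
  let ?B = "\<lambda>l j. if l = j then 1 else if l = Suc j then -1 else (0 :: real)"
  have "fdet m A = fdet m A * fdet m ?B"
    by (subst (2) fdet_lower_triangular) auto
  also have "\<dots> = fdet m (\<lambda>k j. A k j - (if Suc j < m then A k (Suc j) else 0))"
    unfolding fdet_mult
  proof (rule fdet_cong)
    fix k j assume "k < m" "j < m"
    have "(\<Sum>l<m. A k l * ?B l j) = (\<Sum>l<m. (if l = j then A k l else 0) - (if l = Suc j then A k l else 0))"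
      by (intro sum.cong) auto
    also have "\<dots> = A k j - (if Suc j < m then A k (Suc j) else 0)"
      unfolding sum_subtractf using \<open>j < m\<close> by (simp add: sum.delta)
    finally show "(\<Sum>l<m. A k l * ?B l j) = A k j - (if Suc j < m then A k (Suc j) else 0)" .
  qed
  finally show ?thesis ..
qed

section \<open>Tiling counts as determinants, carried through one column\<close>

lemma strict_mono_on_lessThanI:
  fixes f :: "nat \<Rightarrow> nat"
  assumes "\<And>j. Suc j < m \<Longrightarrow> f j < f (Suc j)"
  shows "strict_mono_on {..<m} f"
proof (rule strict_mono_onI)
  fix r s assume "r \<in> {..<m}" "s \<in> {..<m}" "r < s"
  from \<open>r < s\<close> have "Suc r \<le> s" by simp
  hence "s < m \<longrightarrow> f r < f s"
    by (induction s rule: dec_induct) (use assms less_trans in \<open>force+\<close>)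
  thus "f r < f s" using \<open>s \<in> {..<m}\<close> by simp
qed

text \<open>Each odd square picks one of two even squares; choices that collide or leave J contribute a
  determinant with two equal columns or a zero column, so the sum over choices is multilinear.\<close>

lemma M_hop_fdet:
  assumes region: "squares_region R" "\<forall>j. esq (Suc i) j \<notin> R" "\<forall>j. osq i j \<notin> R" "\<forall>j. esq i j \<notin> R"
    and J: "finite J" and q: "strict_mono_on {..<m} q"
    and M: "\<And>p. strict_mono_on {..<m} p \<Longrightarrow> p ` {..<m} \<subseteq> J \<Longrightarrow>
      real (M (R \<union> esq i ` (J - p ` {..<m}))) = fdet m (\<lambda>k j. g k (p j))"
    and g: "\<And>k j x. k < m \<Longrightarrow> j < m \<Longrightarrow> x \<in> {q j, Suc (q j)} \<Longrightarrow> x \<notin> J \<Longrightarrow> g k x = 0"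
  shows "real (M (R \<union> esq i ` J \<union> osq i ` q ` {..<m})) = fdet m (\<lambda>k j. g k (q j) + g k (Suc (q j)))"
proof -
  let ?B = "\<lambda>j. {q j, Suc (q j)}"
  have "real (M (R \<union> esq i ` J \<union> osq i ` q ` {..<m})) = 
    (\<Sum>h\<in>PiE {..<m} ?B. real (if inj_on h {..<m} \<and> h ` {..<m} \<subseteq> J
      then M (R \<union> esq i ` (J - h ` {..<m})) else 0))"
    by (subst M_hop) (use region J q in \<open>auto intro: strict_mono_on_imp_inj_on\<close>)
  also have "\<dots> = (\<Sum>h\<in>PiE {..<m} ?B. fdet m (\<lambda>k j. g k (h j)))"
  proof (rule sum.cong[OF refl])
    fix h assume h: "h \<in> PiE {..<m} ?B"
    have hB: "h j \<in> {q j, Suc (q j)}" if "j < m" for j using h that by (auto simp: PiE_def Pi_def)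
    consider "inj_on h {..<m}" "h ` {..<m} \<subseteq> J" | "\<not> inj_on h {..<m}"
      | j where "j < m" "h j \<notin> J" by blast
    thus "real (if inj_on h {..<m} \<and> h ` {..<m} \<subseteq> J
      then M (R \<union> esq i ` (J - h ` {..<m})) else 0) = fdet m (\<lambda>k j. g k (h j))"
    proof cases
      case 1
      have "strict_mono_on {..<m} h"
      proof (rule strict_mono_onI)
        fix r s assume rs: "r \<in> {..<m}" "s \<in> {..<m}" "r < s"
        have "q r < q s" using q rs by (auto simp: strict_mono_on_def)
        hence "h r \<le> h s" using hB[of r] hB[of s] rs by auto
        moreover have "h r \<noteq> h s" using 1(1) rs by (auto dest: inj_onD)
        ultimately show "h r < h s" by simp
      qed
      thus ?thesis using M 1 by simp
    next
      case 2
      then obtain r s where "r < m" "s < m" "r \<noteq> s" "h r = h s" by (auto simp: inj_on_def)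
      thus ?thesis using 2 by (simp add: fdet_identical_columns[of r m s])
    next
      case (3 j)
      have "fdet m (\<lambda>k j. g k (h j)) = 0"
        by (rule fdet_zero_column[of j]) (use 3 g hB in auto)
      thus ?thesis using 3 by auto
    qed
  qed
  also have "\<dots> = fdet m (\<lambda>k j. \<Sum>x\<in>?B j. g k x)"
    by (rule fdet_sum_columns[symmetric]) simp
  also have "\<dots> = fdet m (\<lambda>k j. g k (q j) + g k (Suc (q j)))"
    by (rule fdet_cong) simp
  finally show ?thesis .
qed

text \<open>Up to sign, \<open>G\<close> is a discrete antiderivative of \<open>g\<close>.
  Multilinearity moves the sum over each segment into its column of the determinant, where it
  telescopes.\<close>

lemma M_segments_fdet:
  assumes region: "squares_region R" "\<forall>j. osq (Suc i) j \<notin> R" "\<forall>j. esq (Suc i) j \<notin> R" "\<forall>j. osq i j \<notin> R"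
    and P: "\<forall>j<m. P j < P (Suc j)"
    and M: "\<And>q. strict_mono_on {..<m} q \<Longrightarrow> q ` {..<m} \<subseteq> {P 0..<P m} \<Longrightarrow>
      real (M (R \<union> osq i ` q ` {..<m})) = fdet m (\<lambda>k j. g k (q j))"
    and G: "\<And>k x. k < m \<Longrightarrow> x \<in> {P 0..<P m} \<Longrightarrow> G k x - G k (Suc x) = g k x"
  shows "real (M (R \<union> osq i ` {P 0..<P m} \<union> esq (Suc i) ` ({P 0..<P m} - P ` {..<m}))) =
    fdet m (\<lambda>k j. G k (P j) - G k (P (Suc j)))"
proof -
  let ?B = "\<lambda>j. {P j..<P (Suc j)}"
  have mono: "P j \<le> P j'" if "j \<le> j'" "j' \<le> m" for j j'
    using that(1,2)
  proof (induction j' rule: dec_induct)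
    case (step j')
    thus ?case using P by (meson Suc_leD Suc_le_lessD le_trans less_imp_le)
  qed simp
  have "real (M (R \<union> osq i ` {P 0..<P m} \<union> esq (Suc i) ` ({P 0..<P m} - P ` {..<m}))) =
    (\<Sum>q\<in>PiE {..<m} ?B. real (M (R \<union> osq i ` q ` {..<m})))"
    by (subst M_segments) (use region P in auto)
  also have "\<dots> = (\<Sum>q\<in>PiE {..<m} ?B. fdet m (\<lambda>k j. g k (q j)))"
  proof (intro sum.cong refl M)
    fix q assume q: "q \<in> PiE {..<m} ?B"
    have qB: "P j \<le> q j \<and> q j < P (Suc j)" if "j < m" for j
      using q that by (auto simp: PiE_def Pi_def)
    show "strict_mono_on {..<m} q"
      by (rule strict_mono_on_lessThanI) (use qB Suc_lessD less_le_trans in blast)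
    show "q ` {..<m} \<subseteq> {P 0..<P m}"
    proof safe
      fix j assume "j < m"
      thus "q j \<in> {P 0..<P m}" using qB[of j] mono[of 0 j] mono[of "Suc j" m] by simp
    qed
  qed
  also have "\<dots> = fdet m (\<lambda>k j. \<Sum>x\<in>?B j. g k x)"
    by (rule fdet_sum_columns[symmetric]) simp
  also have "\<dots> = fdet m (\<lambda>k j. G k (P j) - G k (P (Suc j)))"
  proof (rule fdet_cong)
    fix k j assume kj: "k < m" "j < m"
    have "(\<Sum>x\<in>?B j. g k x) = (\<Sum>x\<in>?B j. - G k (Suc x) - - G k x)"
      using kj mono[of 0 j] mono[of "Suc j" m] by (intro sum.cong refl) (simp add: G[symmetric])
    also have "\<dots> = G k (P j) - G k (P (Suc j))"
      by (subst sum_Suc_diff') (use kj mono[of j "Suc j"] in auto)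
    finally show "(\<Sum>x\<in>?B j. g k x) = G k (P j) - G k (P (Suc j))" .
  qed
  finally show ?thesis .
qed

text \<open>The end \<open>h\<close>, where \<open>G\<close> vanishes, serves as one more position,
  so \<open>m\<close> positions bound \<open>m\<close> segments; below the lowest position all
  dominoes are forced.\<close>

lemma M_interlace_fdet:
  assumes region: "squares_region R" "\<forall>j. osq (Suc i) j \<notin> R" "\<forall>j. esq (Suc i) j \<notin> R" "\<forall>j. osq i j \<notin> R"
    and p: "strict_mono_on {..<m} p" "p ` {..<m} \<subseteq> {l..<h}" and "l \<le> h"
    and M: "\<And>q. strict_mono_on {..<m} q \<Longrightarrow> q ` {..<m} \<subseteq> {l..<h} \<Longrightarrow>
      real (M (R \<union> osq i ` q ` {..<m})) = fdet m (\<lambda>k j. g k (q j))"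
    and G: "\<And>k x. k < m \<Longrightarrow> x \<in> {l..<h} \<Longrightarrow> G k x - G k (Suc x) = g k x" "\<And>k. k < m \<Longrightarrow> G k h = 0"
  shows "real (M (R \<union> osq i ` {l..<h} \<union> esq (Suc i) ` ({l..<h} - p ` {..<m}))) =
    fdet m (\<lambda>k j. G k (p j))"
proof -
  define P where "P j = (if j < m then p j else h)" for j
  have P_less: "\<forall>j<m. P j < P (Suc j)"
    using p by (auto simp: P_def strict_mono_on_def)
  have P0: "l \<le> P 0" "P 0 \<le> h" using p \<open>l \<le> h\<close> by (force simp: P_def)+
  have Pm: "P m = h" by (simp add: P_def)
  have img: "P ` {..<m} = p ` {..<m}" by (simp add: P_def)
  have ge: "P 0 \<le> x" if "x \<in> p ` {..<m}" for x
  proof -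
    from that obtain j where "j < m" "x = p j" by auto
    thus ?thesis using p(1) by (cases "j = 0") (auto simp: P_def strict_mono_on_def intro!: less_imp_le)
  qed
  let ?R = "R \<union> osq i ` {P 0..<P m} \<union> esq (Suc i) ` ({P 0..<P m} - P ` {..<m})"
  have "R \<union> osq i ` {l..<h} \<union> esq (Suc i) ` ({l..<h} - p ` {..<m}) =
    ?R \<union> osq i ` {l..<P 0} \<union> esq (Suc i) ` {l..<P 0}"
  proof -
    have 1: "{l..<h} = {P 0..<P m} \<union> {l..<P 0}" using P0 Pm by auto
    have 2: "{l..<h} - p ` {..<m} = ({P 0..<P m} - P ` {..<m}) \<union> {l..<P 0}"
      unfolding img using P0 Pm ge by force
    show ?thesis unfolding 2 unfolding 1 by (simp add: image_Un Un_ac)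
  qed
  also have "M \<dots> = M ?R"
    by (rule M_forced_up) (use region P0 in auto)
  also have "real \<dots> = fdet m (\<lambda>k j. G k (P j) - G k (P (Suc j)))"
  proof (rule M_segments_fdet[OF region P_less])
    fix q assume q: "strict_mono_on {..<m} q" "q ` {..<m} \<subseteq> {P 0..<P m}"
    have "{P 0..<P m} \<subseteq> {l..<h}" using P0 Pm by auto
    thus "real (M (R \<union> osq i ` q ` {..<m})) = fdet m (\<lambda>k j. g k (q j))"
      using M q by blast
  qed (use G P0 Pm in auto)
  \<comment> \<open>Because \<open>G k h = 0\<close>, the last column has no subtrahend, and the
    columns have exactly the shape that column operations undo.\<close>
  also have "\<dots> = fdet m (\<lambda>k j. G k (p j) - (if Suc j < m then G k (p (Suc j)) else 0))"
    by (rule fdet_cong) (use G in \<open>auto simp: P_def\<close>)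
  also have "\<dots> = fdet m (\<lambda>k j. G k (p j))"
    by (rule fdet_column_differences)
  finally show ?thesis .
qed

text \<open>Here both ends of the column are walls, so there is one more particle p j than q j, and the
  determinant is bordered by a row of ones.\<close>

lemma M_interlace_wide_fdet:
  assumes region: "squares_region R" "\<forall>j. osq (Suc i) j \<notin> R" "\<forall>j. esq (Suc i) j \<notin> R" "\<forall>j. osq i j \<notin> R"
    and p: "strict_mono_on {..<Suc m} p" "p ` {..<Suc m} \<subseteq> {..n}"
    and M: "\<And>q. strict_mono_on {..<m} q \<Longrightarrow> q ` {..<m} \<subseteq> {..<n} \<Longrightarrow>
      real (M (R \<union> osq i ` q ` {..<m})) = fdet m (\<lambda>k j. g k (q j))"
    and G: "\<And>k x. k < m \<Longrightarrow> x < n \<Longrightarrow> G k x - G k (Suc x) = g k x"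
  shows "real (M (R \<union> osq i ` {..<n} \<union> esq (Suc i) ` ({..n} - p ` {..<Suc m}))) =
    fdet (Suc m) (\<lambda>k j. if k < m then G k (p j) else 1)"
proof -
  have p_less: "\<forall>j<m. p j < p (Suc j)"
    using p by (auto simp: strict_mono_on_def)
  have pm: "p m \<le> n" using p by auto
  have bounds: "p 0 \<le> p j \<and> p j \<le> p m" if "j \<le> m" for j
    using p(1) that by (cases "j = 0"; cases "j = m") (auto simp: strict_mono_on_def intro!: less_imp_le)
  let ?R1 = "R \<union> osq i ` {p 0..<p m} \<union> esq (Suc i) ` ({p 0..<p m} - p ` {..<m})"
  let ?R2 = "?R1 \<union> osq i ` {0..<p 0} \<union> esq (Suc i) ` {0..<p 0}"
  have eq: "R \<union> osq i ` {..<n} \<union> esq (Suc i) ` ({..n} - p ` {..<Suc m}) =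
    ?R2 \<union> osq i ` {p m..<n} \<union> esq (Suc i) ` {p m<..n}"
  proof -
    have 1: "{..<n} = {p 0..<p m} \<union> {0..<p 0} \<union> {p m..<n}" using pm bounds[of 0] by auto
    have 2: "{..n} - p ` {..<Suc m} = ({p 0..<p m} - p ` {..<m}) \<union> {0..<p 0} \<union> {p m<..n}"
    proof (intro equalityI subsetI)
      fix x assume "x \<in> {..n} - p ` {..<Suc m}"
      hence "x \<le> n" "x \<notin> p ` {..<m}" "x \<noteq> p m" by auto
      thus "x \<in> ({p 0..<p m} - p ` {..<m}) \<union> {0..<p 0} \<union> {p m<..n}" by auto
    next
      fix x assume x: "x \<in> ({p 0..<p m} - p ` {..<m}) \<union> {0..<p 0} \<union> {p m<..n}"
      have "x \<noteq> p j" if "j < Suc m" for j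
        using x that bounds[of j] by (cases "j = m") auto
      moreover have "x \<le> n" using x pm bounds[of 0] by auto
      ultimately show "x \<in> {..n} - p ` {..<Suc m}" by auto
    qed
    show ?thesis unfolding 2 unfolding 1 by (simp add: image_Un Un_ac)
  qed
  have "M (?R2 \<union> osq i ` {p m..<n} \<union> esq (Suc i) ` {p m<..n}) = M ?R2"
    by (rule M_forced_down) (use region pm bounds[of 0] in auto)
  also have "\<dots> = M ?R1"
    by (rule M_forced_up) (use region in \<open>simp_all add: image_iff\<close>)
  finally have M_eq: "M (R \<union> osq i ` {..<n} \<union> esq (Suc i) ` ({..n} - p ` {..<Suc m})) = M ?R1"
    by (simp only: eq)
  have "real (M ?R1) = fdet m (\<lambda>k j. G k (p j) - G k (p (Suc j)))"
  proof (rule M_segments_fdet[OF region p_less])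
    fix q assume q: "strict_mono_on {..<m} q" "q ` {..<m} \<subseteq> {p 0..<p m}"
    have "{p 0..<p m} \<subseteq> {..<n}" using pm by auto
    thus "real (M (R \<union> osq i ` q ` {..<m})) = fdet m (\<lambda>k j. g k (q j))"
      using M q by blast
  qed (use G pm in auto)
  \<comment> \<open>Differencing the columns turns the row of ones into zeros followed by a single
    1, so expansion along it leads back to size \<open>m\<close>.\<close>
  also have "\<dots> = fdet (Suc m) (\<lambda>k j. (if k < m then G k (p j) else 1) -
     (if Suc j < Suc m then (if k < m then G k (p (Suc j)) else 1) else 0))"
    by (subst fdet_last_row) (auto intro!: fdet_cong)
  also have "\<dots> = fdet (Suc m) (\<lambda>k j. if k < m then G k (p j) else 1)"
    by (rule fdet_column_differences)
  finally show ?thesis by (simp only: M_eq)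
qed

section \<open>The elbow region\<close>

text \<open>The second coordinates of the even and odd squares of the elbow region in a column, for the
  columns up to index n + b; the count b only enters as the number of columns.\<close>

definition esqs :: "nat \<Rightarrow> nat \<Rightarrow> nat \<Rightarrow> nat set" where
  "esqs n a i = (if i \<le> n then {n + 1 - i..<n + a + 1} else {..<n + 1})"

definition osqs :: "nat \<Rightarrow> nat \<Rightarrow> nat \<Rightarrow> nat set" where
  "osqs n a i = (if i < n then {n - i..<n + a + 1} else {..<n})"

fun elbow_cols :: "nat \<Rightarrow> nat \<Rightarrow> nat \<Rightarrow> (int \<times> int) set" where
  "elbow_cols n a 0 = {}"
| "elbow_cols n a (Suc i) = elbow_cols n a i \<union> esq i ` esqs n a i \<union> osq i ` osqs n a i"

lemma finite_esqs [simp]: "finite (esqs n a i)"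
  by (simp add: esqs_def)

lemma finite_osqs [simp]: "finite (osqs n a i)"
  by (simp add: osqs_def)

lemma squares_region_cols [simp]: "squares_region (elbow_cols n a i)"
  by (induction i) auto

lemma esq_in_cols: "esq i j \<in> elbow_cols n a m \<longleftrightarrow> i < m \<and> j \<in> esqs n a i"
  by (induction m) (auto simp: less_Suc_eq)

lemma osq_in_cols: "osq i j \<in> elbow_cols n a m \<longleftrightarrow> i < m \<and> j \<in> osqs n a i"
  by (induction m) (auto simp: less_Suc_eq)

lemma esq_in_elbow: "esq i j \<in> elbow n a b \<longleftrightarrow> i \<le> n + b \<and> j \<in> esqs n a i"
  unfolding elbow_def esq_def esqs_def by auto

lemma osq_in_elbow: "osq i j \<in> elbow n a b \<longleftrightarrow> i \<le> n + b \<and> j \<in> osqs n a i"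
  unfolding elbow_def osq_def osqs_def by auto

lemma elbow_squares:
  assumes "x \<in> elbow n a b"
  obtains i j where "x = esq i j" | i j where "x = osq i j"
proof -
  obtain s t where x: "x = (s, t)" by (cases x)
  have st: "even (s - t)" "0 \<le> s" "0 \<le> t" using assms by (auto simp: elbow_def x)
  show thesis
  proof (cases "even s")
    case True
    hence "x = esq (nat (s div 2)) (nat (t div 2))" using st by (auto simp: x esq_def)
    thus thesis by (rule that(1))
  next
    case False
    hence "x = osq (nat (s div 2)) (nat (t div 2))" using st by (auto simp: x osq_def)
    thus thesis by (rule that(2))
  qed
qed

lemma elbow_eq_cols: "elbow n a b = elbow_cols n a (Suc (n + b))"
proof (intro equalityI subsetI)
  fix x assume x: "x \<in> elbow n a b"
  thus "x \<in> elbow_cols n a (Suc (n + b))"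
    by (cases rule: elbow_squares)
       (use x in \<open>auto simp: esq_in_elbow osq_in_elbow esq_in_cols osq_in_cols simp del: elbow_cols.simps\<close>)
next
  fix x assume x: "x \<in> elbow_cols n a (Suc (n + b))"
  show "x \<in> elbow n a b"
    by (rule squares_regionD[OF squares_region_cols x])
       (use x in \<open>auto simp: esq_in_elbow osq_in_elbow esq_in_cols osq_in_cols simp del: elbow_cols.simps\<close>)
qed

section \<open>Chessboard colouring and balance\<close>

lemma tiling_balanced:
  assumes T: "domino_tiling R T" and R: "finite R"
  shows "(\<Sum>x\<in>R. if even (fst x) then 1 else -1 :: int) = 0"
proof -
  let ?w = "\<lambda>x :: int \<times> int. if even (fst x) then 1 else -1 :: int"
  have "sum ?w (\<Union>T) = (\<Sum>d\<in>T. sum ?w d)"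
  proof (rule sum.Union_disjoint[unfolded o_def])
    show "\<forall>d\<in>T. finite d" using domino_tilingD(3)[OF T] R by (auto intro: finite_subset)
  qed (use domino_tilingD(2)[OF T] in auto)
  also have "\<dots> = 0"
  proof (rule sum.neutral, rule ballI)
    fix d assume "d \<in> T"
    then obtain p q where d: "d = {p, q}" "adjacent p q" using domino_tilingD(1)[OF T] by blast
    hence "p \<noteq> q" by auto
    moreover have "even (fst p) \<longleftrightarrow> odd (fst q)"
      using d(2) unfolding adjacent_def by presburger
    ultimately show "sum ?w d = 0" by (simp add: d(1))
  qed
  finally show ?thesis by (simp add: domino_tilingD(3)[OF T])
qed

lemma sum_cols_Suc:
  "(\<Sum>x\<in>elbow_cols n a (Suc i). f x) =
    (\<Sum>x\<in>elbow_cols n a i. f x) + (\<Sum>j\<in>esqs n a i. f (esq i j)) + (\<Sum>j\<in>osqs n a i. f (osq i j))"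
proof -
  have fin: "finite (elbow_cols n a i)" by (rule squares_region_finite) simp
  have 1: "(elbow_cols n a i \<union> esq i ` esqs n a i) \<inter> osq i ` osqs n a i = {}"
    by (auto simp: osq_in_cols)
  have 2: "elbow_cols n a i \<inter> esq i ` esqs n a i = {}"
    by (auto simp: esq_in_cols)
  show ?thesis
    unfolding elbow_cols.simps
    by (subst sum.union_disjoint[OF _ _ 1], simp_all add: fin,
        subst sum.union_disjoint[OF _ _ 2], simp_all add: fin sum.reindex inj_on_def)
qed

text \<open>Even minus odd squares, column by column: each column before \<open>n\<close>
  contributes -1, column \<open>n\<close> contributes \<open>a\<close>, and each of the
  \<open>b\<close> later ones contributes 1.\<close>

lemma elbow_balanced:
  assumes "domino_tiling (elbow n a b) T"
  shows "a + b = n"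
proof -
  let ?w = "\<lambda>x :: int \<times> int. if even (fst x) then 1 else -1 :: int"
  have step: "sum ?w (elbow_cols n a (Suc i)) = sum ?w (elbow_cols n a i) + int (card (esqs n a i)) - int (card (osqs n a i))" for i
    unfolding sum_cols_Suc by (simp add: esq_def osq_def)
  have left: "sum ?w (elbow_cols n a i) = - int i" if "i \<le> n" for i
    using that
  proof (induction i)
    case (Suc i) thus ?case by (simp add: step esqs_def osqs_def del: elbow_cols.simps(2))
  qed simp
  have "sum ?w (elbow_cols n a (Suc (n + b))) = int a + int b - int n" for b
  proof (induction b)
    case 0
    show ?case by (simp add: step left esqs_def osqs_def del: elbow_cols.simps(2))
  next
    case (Suc b)
    thus ?case
      by (subst step) (simp add: esqs_def osqs_def del: elbow_cols.simps(2))
  qed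
  moreover have "sum ?w (elbow n a b) = 0"
    using tiling_balanced[OF assms] squares_region_finite[OF squares_region_cols]
    by (simp add: elbow_eq_cols del: elbow_cols.simps)
  ultimately have "int a + int b - int n = 0" by (simp add: elbow_eq_cols del: elbow_cols.simps)
  thus ?thesis by linarith
qed

lemma strict_mono_on_lessThan_ge:
  fixes p :: "nat \<Rightarrow> nat"
  assumes p: "strict_mono_on {..<m} p" and l: "p ` {..<m} \<subseteq> {l..}" and j: "j < m"
  shows "l + j \<le> p j"
  using j
proof (induction j)
  case 0 thus ?case using l by auto
next
  case (Suc j)
  moreover have "p j < p (Suc j)" using p Suc.prems by (auto simp: strict_mono_on_def)
  ultimately show ?case by simp
qed

lemma strict_mono_on_full:
  fixes p :: "nat \<Rightarrow> nat"
  assumes p: "strict_mono_on {..<m} p" and l: "p ` {..<m} \<subseteq> {l..<l + m}"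
  shows "p ` {..<m} = {l..<l + m}" and "j < m \<Longrightarrow> p j = l + j"
proof -
  have inj: "inj_on p {..<m}" using p by (rule strict_mono_on_imp_inj_on)
  show img: "p ` {..<m} = {l..<l + m}"
    by (rule card_subset_eq[OF _ l]) (simp_all add: card_image[OF inj])
  have eq: "p j = l + j" if "j < m" for j
    using that
  proof (induction j rule: less_induct)
    case (less j)
    have ge: "l + j \<le> p j"
      by (rule strict_mono_on_lessThan_ge[OF p _ less.prems]) (use l in auto)
    have "l + j \<in> p ` {..<m}" using less.prems img by simp
    then obtain i where i: "i < m" "l + j = p i" by auto
    show ?case
    proof (rule linorder_cases[of i j])
      assume "i < j" thus ?thesis using less.IH[of i] i by simp
    next
      assume "j < i"
      hence "p j < p i" using p i less.prems by (auto simp: strict_mono_on_def)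
      thus ?thesis using ge i by simp
    qed (use i in simp)
  qed
  thus "j < m \<Longrightarrow> p j = l + j" .
qed

section \<open>Propagation of the determinant through the elbow\<close>

text \<open>The effect on a row of the determinant when odd squares are matched to the even squares
  on their left.\<close>

definition shift_sum :: "(nat \<Rightarrow> real) \<Rightarrow> nat \<Rightarrow> real" where
  "shift_sum g j = g j + g (Suc j)"

text \<open>The antiderivative required by the interlacing lemmas, with their sign convention and
  the value 0 at 0.\<close>

definition neg_sum :: "(nat \<Rightarrow> real) \<Rightarrow> nat \<Rightarrow> real" where
  "neg_sum g j = - (\<Sum>x<j. g x)"

text \<open>Row \<open>k\<close> at the even squares of column \<open>n + c\<close>. Each step
  replaces the rows present so far by antiderivatives and adds one constant row, which comes from
  the border of ones.\<close>

fun push :: "nat \<Rightarrow> (nat \<Rightarrow> nat \<Rightarrow> real) \<Rightarrow> nat \<Rightarrow> nat \<Rightarrow> nat \<Rightarrow> real" where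
  "push a g 0 k = g k"
| "push a g (Suc c) k = (if k < a + c then neg_sum (shift_sum (push a g c k)) else (\<lambda>_. 1))"

text \<open>Here \<open>rel\<close> expresses a hop followed by interlacing, \<open>antidiag\<close>
  the staircase boundary, \<open>top\<close> the end of the upper arm, and \<open>start\<close>
  normalises the empty region.\<close>

locale left_kernel =
  fixes n a :: nat and f :: "nat \<Rightarrow> nat \<Rightarrow> nat \<Rightarrow> real"
  assumes rel: "\<And>k i j. f k (Suc i) j - f k (Suc i) (Suc j) = f k i j + f k i (Suc j)"
    and antidiag: "\<And>k i. k < a \<Longrightarrow> i \<le> n \<Longrightarrow> f k i (n - i) = 0"
    and top: "\<And>k i. k < a \<Longrightarrow> f k i (n + a + 1) = 0"
    and start: "fdet a (\<lambda>k j. f k 0 (n + 1 + j)) = 1"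
begin

lemma M_left_hop:
  assumes "i < n"
    and M: "\<And>p. strict_mono_on {..<a} p \<Longrightarrow> p ` {..<a} \<subseteq> esqs n a i \<Longrightarrow>
      real (M (elbow_cols n a i \<union> esq i ` (esqs n a i - p ` {..<a}))) = fdet a (\<lambda>k j. f k i (p j))"
    and q: "strict_mono_on {..<a} q" "q ` {..<a} \<subseteq> {n - i..<n + a + 1}"
  shows "real (M (elbow_cols n a i \<union> esq i ` esqs n a i \<union> osq i ` q ` {..<a})) =
    fdet a (\<lambda>k j. f k i (q j) + f k i (Suc (q j)))"
proof (rule M_hop_fdet)
  fix k j x assume kj: "k < a" "j < a" and x: "x \<in> {q j, Suc (q j)}" "x \<notin> esqs n a i"
  have "q j \<in> {n - i..<n + a + 1}" using q(2) kj by blast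
  \<comment> \<open>The only targets outside the region lie on the antidiagonal or just above the
    arm, and \<open>f\<close> vanishes at both.\<close>
  hence "x = n - i \<or> x = n + a + 1" using x \<open>i < n\<close> by (auto simp: esqs_def)
  thus "f k i x = 0" using antidiag[of k i] top[of k i] kj \<open>i < n\<close> by auto
qed (use q M in \<open>auto simp: esq_in_cols osq_in_cols\<close>)

text \<open>Induction over columns: by \<open>rel\<close>, the values of \<open>f\<close> in column
  \<open>Suc i\<close> form an antiderivative of those in column \<open>i\<close> after a
  hop.\<close>

lemma M_left:
  assumes "i \<le> n" and "strict_mono_on {..<a} p" and "p ` {..<a} \<subseteq> esqs n a i"
  shows "real (M (elbow_cols n a i \<union> esq i ` (esqs n a i - p ` {..<a}))) = fdet a (\<lambda>k j. f k i (p j))"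
  using assms
proof (induction i arbitrary: p)
  case 0
  \<comment> \<open>Column 0 has only \<open>a\<close> even squares, so \<open>p\<close> takes all
    of them and nothing remains to be tiled.\<close>
  have sub: "p ` {..<a} \<subseteq> {n + 1..<n + 1 + a}" using 0 by (auto simp: esqs_def)
  note p = strict_mono_on_full[OF \<open>strict_mono_on {..<a} p\<close> sub]
  have "esqs n a 0 = {n + 1..<n + 1 + a}" by (simp add: esqs_def)
  hence e: "elbow_cols n a 0 \<union> esq 0 ` (esqs n a 0 - p ` {..<a}) = {}" by (simp add: p(1))
  have "fdet a (\<lambda>k j. f k 0 (p j)) = 1"
    using start by (subst fdet_cong[of a _ "\<lambda>k j. f k 0 (n + 1 + j)"]) (use p(2) in auto)
  thus ?case by (simp only: e M_empty)
next
  case (Suc i)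
  have eqs: "osqs n a i = {n - i..<n + a + 1}" "esqs n a (Suc i) = {n - i..<n + a + 1}"
    using Suc.prems by (auto simp: osqs_def esqs_def)
  have "real (M (elbow_cols n a i \<union> esq i ` esqs n a i \<union> osq i ` {n - i..<n + a + 1} \<union>
      esq (Suc i) ` ({n - i..<n + a + 1} - p ` {..<a}))) = fdet a (\<lambda>k j. f k (Suc i) (p j))"
  proof (rule M_interlace_fdet)
    fix q assume q: "strict_mono_on {..<a} q" "q ` {..<a} \<subseteq> {n - i..<n + a + 1}"
    show "real (M (elbow_cols n a i \<union> esq i ` esqs n a i \<union> osq i ` q ` {..<a})) =
      fdet a (\<lambda>k j. f k i (q j) + f k i (Suc (q j)))"
      by (rule M_left_hop) (use Suc q in auto)
  qed (use Suc.prems rel top eqs in \<open>auto simp: esq_in_cols osq_in_cols\<close>)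
  thus ?case by (simp add: eqs)
qed

lemma neg_sum_diff: "neg_sum g x - neg_sum g (Suc x) = g x"
  by (simp add: neg_sum_def)

text \<open>From column \<open>n\<close> on, the odd squares run between two walls, so each step
  uses the wide interlacing lemma and gains one row. The count is taken after the hop.\<close>

lemma M_right:
  assumes "strict_mono_on {..<a + c} q" and "q ` {..<a + c} \<subseteq> {..<n}"
  shows "real (M (elbow_cols n a (n + c) \<union> esq (n + c) ` esqs n a (n + c) \<union> osq (n + c) ` q ` {..<a + c})) =
    fdet (a + c) (\<lambda>k j. shift_sum (push a (\<lambda>k. f k n) c k) (q j))"
  using assms
proof (induction c arbitrary: q)
  case 0
  have "real (M (elbow_cols n a n \<union> esq n ` esqs n a n \<union> osq n ` q ` {..<a})) =
    fdet a (\<lambda>k j. f k n (q j) + f k n (Suc (q j)))"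
  proof (rule M_hop_fdet)
    fix k j x assume kj: "k < a" "j < a" and x: "x \<in> {q j, Suc (q j)}" "x \<notin> esqs n a n"
    have "q j < n" using 0 kj by auto
    \<comment> \<open>The only missing target is height 0, written as \<open>n - n\<close> to match
      \<open>antidiag\<close> in column \<open>n\<close>.\<close>
    hence "x = n - n" using x by (auto simp: esqs_def)
    thus "f k n x = 0" using antidiag[of k n] kj by simp
  qed (use 0 M_left[of n] in \<open>auto simp: esq_in_cols osq_in_cols\<close>)
  thus ?case by (simp add: shift_sum_def)
next
  case (Suc c)
  let ?g = "\<lambda>c k. push a (\<lambda>k. f k n) c k"
  have eqs: "osqs n a (n + c) = {..<n}" "esqs n a (n + Suc c) = {..n}"
    by (auto simp: osqs_def esqs_def)
  have "real (M (elbow_cols n a (n + Suc c) \<union> esq (n + Suc c) ` esqs n a (n + Suc c) \<union>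
      osq (n + Suc c) ` q ` {..<a + Suc c})) = 
    fdet (a + Suc c) (\<lambda>k j. ?g (Suc c) k (q j) + ?g (Suc c) k (Suc (q j)))"
  proof (rule M_hop_fdet)
    fix p assume p: "strict_mono_on {..<a + Suc c} p" "p ` {..<a + Suc c} \<subseteq> esqs n a (n + Suc c)"
    have p': "strict_mono_on {..<Suc (a + c)} p" "p ` {..<Suc (a + c)} \<subseteq> {..n}"
      using p unfolding eqs by simp_all
    have "real (M (elbow_cols n a (n + c) \<union> esq (n + c) ` esqs n a (n + c) \<union> osq (n + c) ` {..<n} \<union>
        esq (Suc (n + c)) ` ({..n} - p ` {..<Suc (a + c)}))) =
      fdet (Suc (a + c)) (\<lambda>k j. if k < a + c then neg_sum (shift_sum (?g c k)) (p j) else 1)"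
      by (rule M_interlace_wide_fdet[OF _ _ _ _ p'(1) p'(2) Suc.IH])
         (auto simp: esq_in_cols osq_in_cols neg_sum_diff)
    thus "real (M (elbow_cols n a (n + Suc c) \<union> esq (n + Suc c) ` (esqs n a (n + Suc c) - p ` {..<a + Suc c}))) =
      fdet (a + Suc c) (\<lambda>k j. ?g (Suc c) k (p j))"
      using eqs by (simp add: if_distrib[of "\<lambda>g. g _"] cong: if_cong)
  next
    fix k j x assume "j < a + Suc c" and x: "x \<in> {q j, Suc (q j)}" "x \<notin> esqs n a (n + Suc c)"
    hence "q j < n" using Suc.prems(2) by auto
    hence "x \<in> esqs n a (n + Suc c)" using x(1) unfolding eqs by auto
    thus "?g (Suc c) k x = 0" using x(2) by simp
  qed (use Suc.prems(1) in \<open>auto simp: esq_in_cols osq_in_cols\<close>)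
  thus ?case by (simp add: shift_sum_def)
qed

text \<open>Since \<open>a + b = n\<close>, the last odd column is completely filled, so
  \<open>q\<close> is the identity.\<close>

lemma M_elbow_fdet:
  assumes "a + b = n"
  shows "real (M (elbow n a b)) = fdet n (\<lambda>k j. shift_sum (push a (\<lambda>k. f k n) b k) j)"
proof -
  have "osqs n a (n + b) = {..<n}" by (simp add: osqs_def)
  thus ?thesis
    using M_right[of b "\<lambda>j. j"] assms by (simp add: elbow_eq_cols strict_mono_on_def)
qed

end

section \<open>Functions satisfying the local rule\<close>

text \<open>Extension by zero to negative indices lets the reflection of \<open>z\<close> to
  \<open>2 * int N - z\<close> be stated without cases.\<close>

definition int_coeff :: "real poly \<Rightarrow> int \<Rightarrow> real" where
  "int_coeff p z = (if z < 0 then 0 else coeff p (nat z))"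

lemma int_coeff_nonneg [simp]: "int_coeff p (int m) = coeff p m"
  by (simp add: int_coeff_def)

text \<open>Coefficient form of \<open>x^(2 N) p(2 / x) = \<sigma> 2^N p(x)\<close>.\<close>

definition skew_palindromic :: "nat \<Rightarrow> real \<Rightarrow> real poly \<Rightarrow> bool" where
  "skew_palindromic N \<sigma> p \<longleftrightarrow>
     (\<forall>z. 2 powi z * int_coeff p z = \<sigma> * 2 ^ N * int_coeff p (2 * int N - z))"

lemma int_coeff_quadratic_mult:
  "int_coeff ([:2, 3, 1:] * p) z = 2 * int_coeff p z + 3 * int_coeff p (z - 1) + int_coeff p (z - 2)"
proof (cases "z < 0")
  case False
  then obtain m where m: "z = int m" by (metis nat_0_le not_less)
  have eq: "[:2, 3, 1:] * p = smult 2 p + pCons 0 (smult 3 p + pCons 0 p)" by simp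
  consider "m = 0" | "m = 1" | m' where "m = Suc (Suc m')" by (metis One_nat_def not0_implies_Suc)
  thus ?thesis
  proof cases
    case (3 m')
    hence "z - 1 = int (Suc m')" "z - 2 = int m'" using m by auto
    thus ?thesis unfolding eq by (simp only: m int_coeff_nonneg) (simp add: 3)
  qed (simp_all add: eq m int_coeff_def)
qed (simp add: int_coeff_def)

text \<open>The factor is \<open>(1 + x) (2 + x)\<close>, which has the symmetry itself with
  \<open>N = 1\<close> and sign 1.\<close>

lemma skew_palindromic_mult:
  assumes "skew_palindromic N \<sigma> p"
  shows "skew_palindromic (Suc N) \<sigma> ([:2, 3, 1:] * p)"
  unfolding skew_palindromic_def
proof
  fix z
  have p: "2 powi z * int_coeff p z = \<sigma> * 2 ^ N * int_coeff p (2 * int N - z)" for z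
    using assms by (simp add: skew_palindromic_def)
  have "2 powi z * int_coeff ([:2, 3, 1:] * p) z =
    2 * (2 powi z * int_coeff p z) + 6 * (2 powi (z - 1) * int_coeff p (z - 1)) + 4 * (2 powi (z - 2) * int_coeff p (z - 2))"
    unfolding int_coeff_quadratic_mult by (simp add: power_int_diff field_simps)
  also have "\<dots> = \<sigma> * 2 ^ Suc N * int_coeff ([:2, 3, 1:] * p) (2 * int (Suc N) - z)"
    unfolding p int_coeff_quadratic_mult by (simp add: algebra_simps)
  finally show "2 powi z * int_coeff ([:2, 3, 1:] * p) z =
    \<sigma> * 2 ^ Suc N * int_coeff ([:2, 3, 1:] * p) (2 * int (Suc N) - z)" .
qed

lemma skew_palindromic_power_mult:
  "skew_palindromic N \<sigma> p \<Longrightarrow> skew_palindromic (N + k) \<sigma> ([:2, 3, 1:] ^ k * p)"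
  by (induction k) (auto dest: skew_palindromic_mult simp: mult.assoc simp del: mult_pCons_left)

lemma skew_palindromic_one: "skew_palindromic 0 1 1"
  by (auto simp: skew_palindromic_def int_coeff_def)

lemma skew_palindromic_base: "skew_palindromic 1 (-1) [:-2, 0, 1:]"
  unfolding skew_palindromic_def
proof
  fix z :: int
  consider "z < 0" | "z = 0" | "z = 1" | "z = 2" | "z > 2" by linarith
  thus "2 powi z * int_coeff [:-2, 0, 1:] z = -1 * 2 ^ 1 * int_coeff [:-2, 0, 1:] (2 * int 1 - z)"
  proof cases
    case 5
    have "coeff [:-2, 0, 1 :: real:] (nat z) = 0" by (rule coeff_eq_0) (use 5 in simp)
    thus ?thesis using 5 by (simp add: int_coeff_def)
  next
    case 1
    have "coeff [:-2, 0, 1 :: real:] (nat (2 - z)) = 0" by (rule coeff_eq_0) (use 1 in simp)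
    thus ?thesis using 1 by (simp add: int_coeff_def)
  qed (simp_all add: int_coeff_def numeral_2_eq_2)
qed

text \<open>With y = w - 1, this is the form (w - 1)^(n - k) (w (w + 1))^(k - 1) (w^2 - 2 w - 1) without its
  first factor; indices start at 0 here, so k + 1 takes the place of k.\<close>

definition kernel_poly :: "nat \<Rightarrow> real poly" where
  "kernel_poly k = [:2, 3, 1:] ^ k * [:-2, 0, 1:]"

lemma skew_palindromic_kernel_poly: "skew_palindromic (Suc k) (-1) (kernel_poly k)"
  using skew_palindromic_power_mult[OF skew_palindromic_base, of k] by (simp add: kernel_poly_def)

lemma degree_kernel_poly: "degree (kernel_poly k) = 2 * k + 2"
proof -
  have "[:2, 3, 1:] ^ k \<noteq> (0 :: real poly)" "[:-2, 0, 1:] \<noteq> (0 :: real poly)" by simp_all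
  hence "degree (kernel_poly k) = degree ([:2, 3, 1 :: real:] ^ k) + degree [:-2, 0, 1 :: real:]"
    unfolding kernel_poly_def by (rule degree_mult_eq)
  thus ?thesis by (simp add: degree_power_eq)
qed

section \<open>Linear functionals on power series and the kernel functions\<close>

text \<open>The weights are the coefficients of the form divided by the binomial coefficients of the
  invariant pairing, normalised such that kernel_fun n k 0 (n + k + 1) = 1.\<close>

definition functional_weight :: "nat \<Rightarrow> nat \<Rightarrow> nat \<Rightarrow> real" where
  "functional_weight n k e = - ((-1) ^ e * coeff (kernel_poly k) e *
     real (2 * n choose (n + k + 1)) / real (2 * n choose (n + k + 1 - e)))"

text \<open>The sum runs up to the degree of \<open>kernel_poly k\<close>, so the lowest index read
  is \<open>n - k - 1\<close> and the subtraction is not truncated for \<open>k < n\<close>.\<close>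

definition coeff_functional :: "nat \<Rightarrow> nat \<Rightarrow> real fps \<Rightarrow> real" where
  "coeff_functional n k F = (\<Sum>e\<le>2 * k + 2. functional_weight n k e * fps_nth F (n + k + 1 - e))"

lemma coeff_functional_add: "coeff_functional n k (F + G) = coeff_functional n k F + coeff_functional n k G"
  by (simp add: coeff_functional_def sum.distrib algebra_simps)

lemma coeff_functional_diff: "coeff_functional n k (F - G) = coeff_functional n k F - coeff_functional n k G"
  by (simp add: coeff_functional_def sum_subtractf algebra_simps)

lemma coeff_functional_const_mult: "coeff_functional n k (fps_const c * F) = c * coeff_functional n k F"
  unfolding coeff_functional_def sum_distrib_left by (intro sum.cong) auto

lemma coeff_functional_sum: "coeff_functional n k (\<Sum>x\<in>A. F x) = (\<Sum>x\<in>A. coeff_functional n k (F x))"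
  unfolding coeff_functional_def fps_sum_nth sum_distrib_left by (rule sum.swap)

abbreviation fps_A :: "real fps" where "fps_A \<equiv> 1 + fps_X"
abbreviation fps_B :: "real fps" where "fps_B \<equiv> fps_const 2 + fps_X"

lemma fps_B_inverse: "fps_B * inverse fps_B = 1"
  by (rule inverse_mult_eq_1') simp

text \<open>Power series and \<open>inverse fps_B\<close> are used because
  \<open>(2 + x)^(n - j)\<close> has a negative exponent for \<open>j > n\<close>.\<close>

definition kernel_fun :: "nat \<Rightarrow> nat \<Rightarrow> nat \<Rightarrow> nat \<Rightarrow> real" where
  "kernel_fun n k i j = coeff_functional n k (fps_A ^ i * fps_X ^ j * fps_B ^ n * inverse fps_B ^ j)"

text \<open>Raising \<open>i\<close> multiplies the series by \<open>1 + x\<close>, raising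
  \<open>j\<close> by \<open>x / (2 + x)\<close>. The first identity is thus the local rule; the
  second shows that \<open>shift_sum\<close> multiplies by
  \<open>2 (1 + x) / (2 + x)\<close>.\<close>

lemma fps_AB_identities:
  "fps_A - fps_A * (fps_X * inverse fps_B) = 1 + fps_X * inverse fps_B"
  "1 + fps_X * inverse fps_B = fps_const 2 * fps_A * inverse fps_B"
proof -
  have 2: "fps_const 2 = (2 :: real fps)" by (simp add: numeral_fps_const)
  have "fps_A - fps_A * (fps_X * inverse fps_B) - (1 + fps_X * inverse fps_B) =
    fps_X * (1 - fps_B * inverse fps_B)" unfolding 2 by (simp add: algebra_simps)
  thus "fps_A - fps_A * (fps_X * inverse fps_B) = 1 + fps_X * inverse fps_B"
    unfolding fps_B_inverse diff_self mult_zero_right right_minus_eq .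
  have "1 + fps_X * inverse fps_B = fps_B * inverse fps_B + fps_X * inverse fps_B"
    by (simp add: fps_B_inverse)
  thus "1 + fps_X * inverse fps_B = fps_const 2 * fps_A * inverse fps_B"
    unfolding 2 by (simp add: algebra_simps)
qed

lemma kernel_fun_rel:
  "kernel_fun n k (Suc i) j - kernel_fun n k (Suc i) (Suc j) = kernel_fun n k i j + kernel_fun n k i (Suc j)"
proof -
  let ?C = "fps_A ^ i * fps_X ^ j * fps_B ^ n * inverse fps_B ^ j"
  have "kernel_fun n k (Suc i) j - kernel_fun n k (Suc i) (Suc j) =
    coeff_functional n k (?C * (fps_A - fps_A * (fps_X * inverse fps_B)))"
    unfolding kernel_fun_def coeff_functional_diff[symmetric] by (rule arg_cong[of _ _ "coeff_functional n k"]) (simp only: power_Suc ring_distribs mult_ac)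
  also have "\<dots> = coeff_functional n k (?C * (1 + fps_X * inverse fps_B))"
    by (simp only: fps_AB_identities(1))
  also have "\<dots> = kernel_fun n k i j + kernel_fun n k i (Suc j)"
    unfolding kernel_fun_def coeff_functional_add[symmetric] by (rule arg_cong[of _ _ "coeff_functional n k"]) (simp only: power_Suc ring_distribs mult_ac mult_1_left)
  finally show ?thesis .
qed

text \<open>The series is divisible by \<open>x^j\<close>, and the functional reads no coefficient
  beyond \<open>n + k + 1\<close>.\<close>

lemma kernel_fun_zero:
  assumes "n + k + 1 < j"
  shows "kernel_fun n k i j = 0"
proof -
  have "fps_nth (fps_A ^ i * fps_X ^ j * fps_B ^ n * inverse fps_B ^ j) r = 0" if "r < j" for r
  proof -
    have "fps_A ^ i * fps_X ^ j * fps_B ^ n * inverse fps_B ^ j =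
      fps_X ^ j * (fps_A ^ i * fps_B ^ n * inverse fps_B ^ j)" by (simp only: mult_ac)
    thus ?thesis using that by (simp only: fps_X_power_mult_nth if_True)
  qed
  thus ?thesis unfolding kernel_fun_def coeff_functional_def using assms by (intro sum.neutral) auto
qed

lemma coeff_kernel_poly_0: "coeff (kernel_poly k) 0 = - (2 ^ Suc k)"
  by (simp add: kernel_poly_def coeff_mult coeff_0_power)

text \<open>Only \<open>e = 0\<close> reaches the leading coefficient \<open>1 / 2 ^ Suc k\<close>;
  the constant term of \<open>kernel_poly k\<close> and the sign in \<open>functional_weight\<close>
  normalise it to 1.\<close>

lemma kernel_fun_top:
  assumes "k < n"
  shows "kernel_fun n k 0 (n + k + 1) = 1"
proof -
  let ?D = "fps_B ^ n * inverse fps_B ^ (n + k + 1)"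
  have nth: "fps_nth (fps_X ^ (n + k + 1) * ?D) (n + k + 1 - e) = (if e = 0 then 1 / 2 ^ Suc k else 0)" for e
  proof (cases "e = 0")
    case True
    have "fps_nth (fps_X ^ (n + k + 1) * ?D) (n + k + 1) = fps_nth ?D 0"
      by (simp only: fps_X_power_mult_nth) simp
    also have "\<dots> = 2 ^ n * (1 / 2) ^ (n + k + 1)" by (simp add: fps_power_zeroth)
    also have "\<dots> = 1 / 2 ^ Suc k" by (simp add: power_add power_one_over field_simps)
    finally show ?thesis using True by simp
  next
    case False
    thus ?thesis by (simp only: fps_X_power_mult_nth) simp
  qed
  have "kernel_fun n k 0 (n + k + 1) = coeff_functional n k (fps_X ^ (n + k + 1) * ?D)"
    unfolding kernel_fun_def by (simp only: power_0 mult_1_left mult.assoc)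
  also have "\<dots> = (\<Sum>e\<le>2 * k + 2. if e = 0 then functional_weight n k e * (1 / 2 ^ Suc k) else 0)"
    unfolding coeff_functional_def nth by (intro sum.cong) auto
  also have "\<dots> = functional_weight n k 0 * (1 / 2 ^ Suc k)" by (simp add: sum.delta)
  also have "\<dots> = 1" using assms by (simp add: functional_weight_def coeff_kernel_poly_0)
  finally show ?thesis .
qed

lemma fps_AB_eq: "fps_A * fps_B = fps_of_poly [:2, 3, 1:]"
proof -
  have 2: "fps_const c = fps_of_poly [:c:]" "fps_X = fps_of_poly [:0, 1:]" "1 = fps_of_poly (1 :: real poly)" for c :: real
    by (simp_all add: fps_of_poly_const fps_of_poly_fps_X)
  show ?thesis unfolding 2 fps_of_poly_add[symmetric] fps_of_poly_mult[symmetric]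
    by (rule arg_cong[of _ _ fps_of_poly]) (simp add: one_pCons)
qed

text \<open>For \<open>j = n - i\<close> the series is the polynomial
  \<open>x^(n - i) ((1 + x) (2 + x))^i\<close>. It is symmetric under x -> 2 / x while the weights
  are antisymmetric, so the terms for \<open>e\<close> and \<open>2 * K - e\<close> cancel.\<close>

lemma kernel_fun_antidiag:
  assumes "k < n" "i \<le> n"
  shows "kernel_fun n k i (n - i) = 0"
proof -
  define K where "K = Suc k"
  let ?w = "int_coeff ([:2, 3, 1:] ^ i)"
  let ?v = "coeff (kernel_poly k)"
  have "fps_A ^ i * fps_X ^ (n - i) * fps_B ^ n * inverse fps_B ^ (n - i) =
    fps_X ^ (n - i) * (fps_A * fps_B) ^ i"
  proof -
    have "fps_B ^ n * inverse fps_B ^ (n - i) = fps_B ^ i * (fps_B * inverse fps_B) ^ (n - i)"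
      using assms by (simp add: power_mult_distrib mult_ac flip: power_add)
    thus ?thesis by (simp add: fps_B_inverse power_mult_distrib mult_ac)
  qed
  also have "\<dots> = fps_X ^ (n - i) * fps_of_poly ([:2, 3, 1:] ^ i)"
    by (simp only: fps_AB_eq fps_of_poly_power)
  finally have ser: "fps_A ^ i * fps_X ^ (n - i) * fps_B ^ n * inverse fps_B ^ (n - i) = \<dots>" .
  have nth: "fps_nth (fps_X ^ (n - i) * fps_of_poly ([:2, 3, 1:] ^ i)) (n + k + 1 - e) = ?w (int (i + K) - int e)"
    if "e \<le> 2 * K" for e
    using that assms by (auto simp: fps_X_power_mult_nth int_coeff_def K_def intro!: arg_cong[of _ _ "coeff _"])
  define t where "t e = functional_weight n k e * ?w (int (i + K) - int e)" for e
  have t: "t (2 * K - e) = - t e" if e: "e \<le> 2 * K" for e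
  proof -
    have V: "2 ^ e * ?v e = - (2 ^ K * ?v (2 * K - e))"
      using skew_palindromic_kernel_poly[of k, unfolded skew_palindromic_def, rule_format, of "int e"] e
      by (simp add: K_def of_nat_diff flip: int_coeff_nonneg)
    have W: "2 powi (int (i + K) - int e) * ?w (int (i + K) - int e) = 2 ^ i * ?w (int i - int K + int e)"
      using skew_palindromic_power_mult[OF skew_palindromic_one, of i, unfolded skew_palindromic_def, rule_format, of "int (i + K) - int e"]
      by (simp add: algebra_simps)
    have pw: "(2 :: real) ^ e * 2 powi (int (i + K) - int e) = 2 ^ K * 2 ^ i"
      by (simp add: power_int_diff power_int_add)
    have "(2 ^ K * 2 ^ i) * (?v e * ?w (int (i + K) - int e)) =
       (2 ^ e * ?v e) * (2 powi (int (i + K) - int e) * ?w (int (i + K) - int e))"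
      unfolding pw[symmetric] by simp
    also have "\<dots> = (2 ^ K * 2 ^ i) * - (?v (2 * K - e) * ?w (int i - int K + int e))"
      unfolding V W by simp
    finally have VW: "?v e * ?w (int (i + K) - int e) = - (?v (2 * K - e) * ?w (int i - int K + int e))"
      by (rule iffD1[OF mult_left_cancel, rotated]) simp
    \<comment> \<open>The two lower indices add up to \<open>2 * n\<close>.\<close>
    have ch: "2 * n choose (n + k + 1 - (2 * K - e)) = 2 * n choose (n + k + 1 - e)"
      using binomial_symmetric[of "n + k + 1 - e" "2 * n"] assms e by (simp add: K_def)
    have sg: "(- 1 :: real) ^ (2 * K - e) = (- 1) ^ e"
      using e by (simp add: minus_one_power_iff)
    have ix: "int (i + K) - int (2 * K - e) = int i - int K + int e" using e by simp
    have alg: "- (s * x' * c / d) * w' = - (- (s * x * c / d) * w)" if "x * w = - (x' * w')"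
      for s x x' c d w w' :: real
    proof -
      have "- (s * x' * c / d) * w' = (s * c / d) * - (x' * w')" by simp
      also have "\<dots> = - (- (s * x * c / d) * w)" unfolding that[symmetric] by simp
      finally show ?thesis .
    qed
    show ?thesis
      unfolding t_def functional_weight_def ch sg ix by (rule alg[OF VW])
  qed
  have "kernel_fun n k i (n - i) = (\<Sum>e\<le>2 * K. t e)"
    unfolding kernel_fun_def ser coeff_functional_def t_def
  proof (rule sum.cong)
    fix e assume "e \<in> {..2 * K}"
    hence "e \<le> 2 * K" by simp
    from nth[OF this] show "functional_weight n k e *
        fps_nth (fps_X ^ (n - i) * fps_of_poly ([:2, 3, 1:] ^ i)) (n + k + 1 - e) =
      functional_weight n k e * ?w (int (i + K) - int e)" by (simp only:)
  qed (simp add: K_def)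
  moreover have "(\<Sum>e\<le>2 * K. t e) = (\<Sum>e\<le>2 * K. t (2 * K - e))"
    by (rule sum.reindex_bij_witness[of _ "\<lambda>e. 2 * K - e" "\<lambda>e. 2 * K - e"]) auto
  moreover have "\<dots> = (\<Sum>e\<le>2 * K. - t e)" by (intro sum.cong) (auto simp: t)
  moreover have "(\<Sum>e\<le>2 * K. - t e) = - (\<Sum>e\<le>2 * K. t e)" by (rule sum_negf)
  ultimately show ?thesis by linarith
qed

lemma shift_sum_kernel_fun:
  "(shift_sum ^^ m) (kernel_fun n k i) j =
    2 ^ m * coeff_functional n k (fps_A ^ (i + m) * fps_X ^ j * fps_B ^ n * inverse fps_B ^ (j + m))"
proof (induction m arbitrary: j)
  case 0
  thus ?case by (simp add: kernel_fun_def)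
next
  case (Suc m)
  let ?C = "fps_A ^ (i + m) * fps_X ^ j * fps_B ^ n * inverse fps_B ^ (j + m)"
  have "(shift_sum ^^ Suc m) (kernel_fun n k i) j = 
    2 ^ m * coeff_functional n k (?C + fps_A ^ (i + m) * fps_X ^ Suc j * fps_B ^ n * inverse fps_B ^ (Suc j + m))"
    unfolding funpow.simps o_apply shift_sum_def[of "(shift_sum ^^ m) _"] Suc coeff_functional_add ring_distribs ..
  also have "?C + fps_A ^ (i + m) * fps_X ^ Suc j * fps_B ^ n * inverse fps_B ^ (Suc j + m) =
    ?C * (1 + fps_X * inverse fps_B)"
  proof -
    have "x * y * z * w + x * (X * y) * z * (v * w) = x * y * z * w * (1 + X * v)"
      for x y z w v X :: "real fps" by (simp add: algebra_simps)
    thus ?thesis unfolding power_Suc add_Suc .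
  qed
  also have "2 ^ m * coeff_functional n k (?C * (1 + fps_X * inverse fps_B)) = 2 ^ m * coeff_functional n k (fps_const 2 * (?C * fps_A * inverse fps_B))"
    unfolding fps_AB_identities(2) by (simp only: mult_ac)
  also have "\<dots> = 2 ^ Suc m * coeff_functional n k (?C * fps_A * inverse fps_B)"
    unfolding coeff_functional_const_mult by simp
  finally show ?case by (simp only: power_Suc add_Suc_right mult_ac)
qed

section \<open>Alternating binomial sums and orders of vanishing\<close>

text \<open>Up to a scalar this is the value of the functional on a power of \<open>1 + x\<close>;
  \<open>q\<close> is the order of vanishing at -1 against which \<open>p\<close> is tested.\<close>

definition alt_binomial_sum :: "nat \<Rightarrow> nat \<Rightarrow> real poly \<Rightarrow> real" where
  "alt_binomial_sum c q p = (\<Sum>e\<le>degree p. coeff p e * (-1) ^ e * real ((c + e) choose q))"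

lemma alt_binomial_sum_eq:
  assumes "degree p \<le> N"
  shows "alt_binomial_sum c q p = (\<Sum>e\<le>N. coeff p e * (-1) ^ e * real ((c + e) choose q))"
  unfolding alt_binomial_sum_def
  by (rule sum.mono_neutral_left) (use assms in \<open>auto simp: coeff_eq_0\<close>)

lemma alt_binomial_sum_0: "alt_binomial_sum c 0 p = poly p (-1)"
  by (simp add: alt_binomial_sum_def poly_altdef)

text \<open>A factor \<open>1 + x\<close> takes a difference of binomial coefficients in
  \<open>e\<close>, and Pascal's rule lowers \<open>q\<close> by one.\<close>

lemma alt_binomial_sum_mult:
  "alt_binomial_sum c q ([:1, 1:] * p) = (if q = 0 then 0 else - alt_binomial_sum c (q - 1) p)"
proof (cases q)
  case 0
  thus ?thesis by (simp add: alt_binomial_sum_0)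
next
  case (Suc q')
  let ?N = "degree p"
  let ?T = "\<lambda>p e. coeff p e * (-1) ^ e * real ((c + e) choose q)"
  have eq: "[:1, 1:] * p = p + pCons 0 p" by simp
  have "degree (p + pCons 0 p) \<le> Suc ?N"
    by (intro degree_add_le) (auto simp: degree_pCons_le)
  hence "alt_binomial_sum c q ([:1, 1:] * p) = (\<Sum>e\<le>Suc ?N. ?T p e) + (\<Sum>e\<le>Suc ?N. ?T (pCons 0 p) e)"
    unfolding eq by (subst alt_binomial_sum_eq) (auto simp: algebra_simps sum.distrib)
  also have "(\<Sum>e\<le>Suc ?N. ?T p e) = (\<Sum>e\<le>?N. ?T p e)"
    by (simp add: coeff_eq_0)
  also have "(\<Sum>e\<le>Suc ?N. ?T (pCons 0 p) e) = (\<Sum>e\<le>?N. - (coeff p e * (-1) ^ e * real ((c + Suc e) choose q)))"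
    unfolding sum.atMost_Suc_shift by (simp add: sum_negf)
  also have "(\<Sum>e\<le>?N. ?T p e) + \<dots> = - alt_binomial_sum c q' p"
    unfolding alt_binomial_sum_def sum_negf[symmetric] sum.distrib[symmetric] Suc
    by (intro sum.cong) (auto simp: algebra_simps)
  finally show ?thesis using Suc by simp
qed

lemma alt_binomial_sum_power_mult:
  "alt_binomial_sum c q ([:1, 1:] ^ k * p) = (if q < k then 0 else (-1) ^ k * alt_binomial_sum c (q - k) p)"
proof (induction k arbitrary: q)
  case (Suc k)
  have "alt_binomial_sum c q ([:1, 1:] ^ Suc k * p) =
    alt_binomial_sum c q ([:1, 1:] * ([:1, 1:] ^ k * p))" by (simp only: power_Suc mult.assoc)
  also have "\<dots> = (if q < Suc k then 0 else (-1) ^ Suc k * alt_binomial_sum c (q - Suc k) p)"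
    unfolding alt_binomial_sum_mult Suc by auto
  finally show ?case .
qed simp

lemma kernel_poly_eq: "kernel_poly k = [:1, 1:] ^ k * ([:2, 1:] ^ k * [:-2, 0, 1:])"
proof -
  have "[:2, 3, 1 :: real:] = [:1, 1:] * [:2, 1:]" by simp
  thus ?thesis unfolding kernel_poly_def by (simp only: power_mult_distrib mult.assoc)
qed

text \<open>The \<open>k\<close>-fold zero of \<open>kernel_poly k\<close> at -1 uses up
  \<open>k\<close> units of \<open>q\<close>; for \<open>q = k\<close> the cofactor is evaluated at
  -1.\<close>

lemma alt_binomial_sum_kernel_poly:
  "q < k \<Longrightarrow> alt_binomial_sum c q (kernel_poly k) = 0"
  "alt_binomial_sum c k (kernel_poly k) = (-1) ^ Suc k"
  unfolding kernel_poly_eq alt_binomial_sum_power_mult by (simp_all add: alt_binomial_sum_0)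

text \<open>The quotient \<open>(N choose r) / (2 n choose r)\<close> equals
  \<open>(2 n - r choose 2 n - N)\<close> up to a factor independent of \<open>r\<close>, so the
  denominators of the weights yield an alternating binomial sum.\<close>

lemma coeff_functional_power:
  assumes "k < n" "N \<le> 2 * n"
  shows "coeff_functional n k (fps_A ^ N) = - (real (2 * n choose (n + k + 1)) / real (2 * n choose N) *
    alt_binomial_sum (n - k - 1) (2 * n - N) (kernel_poly k))"
proof -
  have nth: "fps_nth (fps_A ^ N) r = real (N choose r)" for r
  proof -
    have "fps_A ^ N = (fps_X + 1) ^ N" by (simp add: add.commute)
    also have "\<dots> = (\<Sum>r\<le>N. fps_const (real (N choose r)) * fps_X ^ r)"
      by (simp add: binomial_ring fps_of_nat)
    finally show ?thesis
      by (simp add: fps_sum_nth if_distrib[of "(*) _"] binomial_eq_0 cong: if_cong)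
  qed
  have ratio: "real (N choose r) / real (2 * n choose r) = real ((2 * n - r) choose (2 * n - N)) / real (2 * n choose N)"
    if "r \<le> 2 * n" for r
  proof (cases "r \<le> N")
    case True
    have "(2 * n choose N) * (N choose r) = (2 * n choose r) * ((2 * n - r) choose (N - r))"
      using choose_mult[OF True assms(2)] .
    also have "(2 * n - r) choose (N - r) = (2 * n - r) choose (2 * n - N)"
      using binomial_symmetric[of "N - r" "2 * n - r"] True assms by simp
    finally have "real (2 * n choose N) * real (N choose r) = real (2 * n choose r) * real ((2 * n - r) choose (2 * n - N))"
      by (metis of_nat_mult)
    thus ?thesis using assms that by (simp add: field_simps)
  next
    case False
    thus ?thesis using assms that by (simp add: binomial_eq_0)
  qed
  have "coeff_functional n k (fps_A ^ N) = (\<Sum>e\<le>2 * k + 2. - (real (2 * n choose (n + k + 1)) / real (2 * n choose N) *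
     (coeff (kernel_poly k) e * (-1) ^ e * real ((n - k - 1 + e) choose (2 * n - N)))))"
    unfolding coeff_functional_def nth
  proof (intro sum.cong refl)
    fix e assume "e \<in> {..2 * k + 2}"
    hence e: "e \<le> 2 * k + 2" by simp
    have ix: "2 * n - (n + k + 1 - e) = n - k - 1 + e" using e assms by simp
    have "functional_weight n k e * real (N choose (n + k + 1 - e)) =
      - ((-1) ^ e * coeff (kernel_poly k) e * real (2 * n choose (n + k + 1))) * 
        (real (N choose (n + k + 1 - e)) / real (2 * n choose (n + k + 1 - e)))"
      by (simp add: functional_weight_def)
    also have "\<dots> = - (real (2 * n choose (n + k + 1)) / real (2 * n choose N) *
     (coeff (kernel_poly k) e * (-1) ^ e * real ((n - k - 1 + e) choose (2 * n - N))))"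
      by (subst ratio) (use e assms ix in \<open>auto simp: field_simps\<close>)
    finally show "functional_weight n k e * real (N choose (n + k + 1 - e)) = \<dots>" .
  qed
  also have "\<dots> = - (real (2 * n choose (n + k + 1)) / real (2 * n choose N) *
    alt_binomial_sum (n - k - 1) (2 * n - N) (kernel_poly k))"
    unfolding alt_binomial_sum_def degree_kernel_poly sum_distrib_left sum_negf ..
  finally show ?thesis .
qed

text \<open>At position 0 the series is \<open>(1 + x)^(n + m) (2 + x)^(n - m)\<close> up to the
  factor \<open>2 ^ m\<close>; writing \<open>2 + x = (1 + x) + 1\<close> expands it in powers of
  \<open>1 + x\<close>.\<close>

lemma shift_sum_kernel_fun_at_0:
  assumes "m \<le> n"
  shows "(shift_sum ^^ m) (kernel_fun n k n) 0 =
    2 ^ m * (\<Sum>e\<le>n - m. real ((n - m) choose e) * coeff_functional n k (fps_A ^ (n + m + e)))"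
proof -
  have "fps_B ^ n * inverse fps_B ^ m = fps_B ^ (n - m) * (fps_B * inverse fps_B) ^ m"
    using assms by (simp add: power_mult_distrib mult_ac flip: power_add)
  hence "fps_A ^ (n + m) * fps_X ^ 0 * fps_B ^ n * inverse fps_B ^ (0 + m) = fps_A ^ (n + m) * fps_B ^ (n - m)"
    by (simp add: fps_B_inverse mult.assoc)
  also have "fps_B = fps_A + 1"
  proof -
    have "fps_const 2 = (1 + 1 :: real fps)" by (simp add: numeral_fps_const)
    thus ?thesis by simp
  qed
  hence "fps_B ^ (n - m) = (\<Sum>e\<le>n - m. of_nat ((n - m) choose e) * fps_A ^ e)"
    by (simp only: binomial_ring power_one mult_1_right)
  also have "fps_A ^ (n + m) * \<dots> = (\<Sum>e\<le>n - m. fps_const (real ((n - m) choose e)) * fps_A ^ (n + m + e))"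
    by (simp add: sum_distrib_left power_add mult_ac fps_of_nat)
  finally show ?thesis
    unfolding shift_sum_kernel_fun by (simp only: coeff_functional_sum coeff_functional_const_mult)
qed

text \<open>Every power \<open>N\<close> that occurs satisfies \<open>N >= n + m > 2 n - k\<close>,
  so each alternating sum has \<open>q < k\<close>.\<close>

lemma shift_sum_kernel_fun_vanish:
  assumes "k < n" "m \<le> n" "n < m + k"
  shows "(shift_sum ^^ m) (kernel_fun n k n) 0 = 0"
  unfolding shift_sum_kernel_fun_at_0[OF assms(2)]
  using assms by (simp add: coeff_functional_power alt_binomial_sum_kernel_poly)

text \<open>At \<open>m = n - k\<close> only the lowest power, \<open>2 n - k\<close>,
  survives.\<close>

lemma shift_sum_kernel_fun_corner:
  assumes "k < n"
  shows "\<bar>(shift_sum ^^ (n - k)) (kernel_fun n k n) 0\<bar> =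
    2 ^ (n - k) * (real (2 * n choose (n - k - 1)) / real (2 * n choose k))"
proof -
  have "(\<Sum>e\<le>n - (n - k). real ((n - (n - k)) choose e) * coeff_functional n k (fps_A ^ (n + (n - k) + e))) =
    (\<Sum>e\<le>k. if e = 0 then coeff_functional n k (fps_A ^ (2 * n - k)) else 0)"
    using assms by (intro sum.cong) (auto simp: coeff_functional_power alt_binomial_sum_kernel_poly mult_2)
  also have "\<dots> = coeff_functional n k (fps_A ^ (2 * n - k))" by simp
  also have "\<dots> = - (real (2 * n choose (n + k + 1)) / real (2 * n choose (2 * n - k)) * (-1) ^ Suc k)"
    using assms by (simp add: coeff_functional_power alt_binomial_sum_kernel_poly)
  also have "2 * n choose (n + k + 1) = 2 * n choose (n - k - 1)"
    using binomial_symmetric[of "n + k + 1" "2 * n"] assms by simp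
  also have "2 * n choose (2 * n - k) = 2 * n choose k"
    using binomial_symmetric[of k "2 * n"] assms by simp
  finally show ?thesis
    by (subst shift_sum_kernel_fun_at_0) (auto simp: abs_mult power_abs)
qed

section \<open>Evaluation of the determinant\<close>

lemma kernel_fun_left_kernel:
  assumes "a \<le> n"
  shows "left_kernel n a (kernel_fun n)"
proof
  show "fdet a (\<lambda>k j. kernel_fun n k 0 (n + 1 + j)) = 1"
  proof (subst fdet_lower_triangular)
    show "kernel_fun n k 0 (n + 1 + j) = 0" if "k < j" for k j
      by (rule kernel_fun_zero) (use that in simp)
    show "(\<Prod>k<a. kernel_fun n k 0 (n + 1 + k)) = 1"
      by (rule prod.neutral) (use assms kernel_fun_top[of _ n] in \<open>auto simp: add_ac\<close>)
  qed
qed (use assms in \<open>auto simp: kernel_fun_rel kernel_fun_antidiag kernel_fun_zero\<close>)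

section \<open>Difference and sum operators on the columns\<close>

definition diff_fun :: "(nat \<Rightarrow> real) \<Rightarrow> nat \<Rightarrow> real" where
  "diff_fun g j = g (Suc j) - g j"

lemma shift_sum_scale: "shift_sum (\<lambda>j. x * g j) = (\<lambda>j. x * shift_sum g j)"
  by (simp add: fun_eq_iff shift_sum_def algebra_simps)

lemma diff_fun_scale: "diff_fun (\<lambda>j. x * g j) = (\<lambda>j. x * diff_fun g j)"
  by (simp add: fun_eq_iff diff_fun_def algebra_simps)

lemma funpow_shift_sum_scale: "(shift_sum ^^ m) (\<lambda>j. x * g j) = (\<lambda>j. x * (shift_sum ^^ m) g j)"
  by (induction m) (simp_all add: shift_sum_scale)

lemma funpow_diff_fun_scale: "(diff_fun ^^ m) (\<lambda>j. x * g j) = (\<lambda>j. x * (diff_fun ^^ m) g j)"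
  by (induction m) (simp_all add: diff_fun_scale)

lemma diff_fun_funpow_shift_sum: "diff_fun ((shift_sum ^^ m) g) = (shift_sum ^^ m) (diff_fun g)"
proof (induction m)
  case (Suc m)
  have "diff_fun (shift_sum h) = shift_sum (diff_fun h)" for h
    by (simp add: fun_eq_iff shift_sum_def diff_fun_def)
  thus ?case using Suc by simp
qed simp

lemma diff_fun_neg_sum: "diff_fun (neg_sum g) = (\<lambda>j. (-1) * g j)"
  by (simp add: fun_eq_iff diff_fun_def neg_sum_def)

abbreviation neg_sum_shift :: "(nat \<Rightarrow> real) \<Rightarrow> nat \<Rightarrow> real" where
  "neg_sum_shift g \<equiv> neg_sum (shift_sum g)"

text \<open>Each difference cancels one \<open>neg_sum\<close> up to sign and releases the
  \<open>shift_sum\<close> inside it.\<close>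

lemma funpow_diff_fun_neg_sum_shift:
  "(diff_fun ^^ d) ((shift_sum ^^ m) ((neg_sum_shift ^^ (c + d)) h)) =
    (\<lambda>j. (-1) ^ d * (shift_sum ^^ (m + d)) ((neg_sum_shift ^^ c) h) j)"
proof (induction d arbitrary: m)
  case (Suc d)
  let ?U = "(neg_sum_shift ^^ (c + d)) h"
  have "(diff_fun ^^ Suc d) ((shift_sum ^^ m) ((neg_sum_shift ^^ (c + Suc d)) h)) =
    (diff_fun ^^ d) ((shift_sum ^^ m) (diff_fun (neg_sum (shift_sum ?U))))"
    by (simp add: funpow_swap1 diff_fun_funpow_shift_sum)
  also have "\<dots> = (\<lambda>j. (-1) * (diff_fun ^^ d) ((shift_sum ^^ Suc m) ?U) j)"
    unfolding diff_fun_neg_sum funpow_shift_sum_scale funpow_diff_fun_scale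
    by (simp add: funpow_swap1)
  finally show ?case unfolding Suc by simp
qed simp

lemma push_left: "k < a \<Longrightarrow> push a g c k = (neg_sum_shift ^^ c) (g k)"
  by (induction c) simp_all

text \<open>Row \<open>a + i\<close> is created in step \<open>Suc i\<close>, so it undergoes only
  the \<open>c\<close> remaining steps.\<close>

lemma push_new: "push a g (Suc (c + i)) (a + i) = (neg_sum_shift ^^ c) (\<lambda>_. 1)"
  by (induction c) simp_all

text \<open>The operator has leading coefficient 1 at l, so that replacing evaluation at l by corner b l
  does not change the determinant.\<close>

definition corner :: "nat \<Rightarrow> nat \<Rightarrow> (nat \<Rightarrow> real) \<Rightarrow> real" where
  "corner b l g = (shift_sum ^^ (l - b)) ((diff_fun ^^ min l b) g) 0"

definition monic_operator :: "nat \<Rightarrow> ((nat \<Rightarrow> real) \<Rightarrow> nat \<Rightarrow> real) \<Rightarrow> bool" where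
  "monic_operator d T \<longleftrightarrow> (\<exists>c. c d = 1 \<and> (\<forall>g j. T g j = (\<Sum>i\<le>d. c i * g (j + i))))"

lemma monic_operator_Suc:
  assumes "monic_operator d T" and S: "\<And>g j. S g j = x * T g j + T g (Suc j)"
  shows "monic_operator (Suc d) S"
proof -
  from assms(1) obtain c where c: "c d = 1" "\<And>g j. T g j = (\<Sum>i\<le>d. c i * g (j + i))"
    unfolding monic_operator_def by auto
  define c' where "c' i = (if i \<le> d then x * c i else 0) + (if i = 0 then 0 else c (i - 1))" for i
  have "S g j = (\<Sum>i\<le>Suc d. c' i * g (j + i))" for g j
  proof -
    have "(\<Sum>i\<le>Suc d. c' i * g (j + i)) = (\<Sum>i\<le>Suc d. (if i \<le> d then x * c i else 0) * g (j + i)) +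
      (\<Sum>i\<le>Suc d. (if i = 0 then 0 else c (i - 1)) * g (j + i))"
      by (simp only: c'_def distrib_right sum.distrib)
    also have "(\<Sum>i\<le>Suc d. (if i \<le> d then x * c i else 0) * g (j + i)) = x * T g j"
      by (simp add: c(2) sum_distrib_left mult.assoc)
    also have "(\<Sum>i\<le>Suc d. (if i = 0 then 0 else c (i - 1)) * g (j + i)) = T g (Suc j)"
      unfolding sum.atMost_Suc_shift by (simp add: c(2))
    finally show ?thesis by (simp add: S)
  qed
  moreover have "c' (Suc d) = 1" by (simp add: c'_def c(1))
  ultimately show ?thesis unfolding monic_operator_def by blast
qed

lemma monic_operator_corner: "monic_operator l (\<lambda>g. (shift_sum ^^ (l - b)) ((diff_fun ^^ min l b) g))"
proof -
  have diff: "monic_operator d (\<lambda>g. (diff_fun ^^ d) g)" for d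
  proof (induction d)
    case 0
    show ?case by (auto simp: monic_operator_def intro: exI[of _ "\<lambda>_. 1"])
  next
    case (Suc d)
    show ?case by (rule monic_operator_Suc[OF Suc, of _ "-1"]) (simp add: diff_fun_def)
  qed
  have shift: "monic_operator (d + m) (\<lambda>g. (shift_sum ^^ m) ((diff_fun ^^ d) g))" for d m
  proof (induction m)
    case 0
    show ?case using diff by simp
  next
    case (Suc m)
    have "monic_operator (Suc (d + m)) (\<lambda>g. (shift_sum ^^ Suc m) ((diff_fun ^^ d) g))"
      by (rule monic_operator_Suc[OF Suc, of _ 1]) (simp add: shift_sum_def[of "(shift_sum ^^ m) _"])
    thus ?case by simp
  qed
  have "min l b + (l - b) = l" by simp
  thus ?thesis using shift[of "min l b" "l - b"] by simp
qed

lemma fdet_corner: "fdet n (\<lambda>k l. corner b l (g k)) = fdet n g"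
proof -
  have "\<exists>c. c l = 1 \<and> (\<forall>g. corner b l g = (\<Sum>i\<le>l. c i * g i))" for l
  proof -
    obtain c where "c l = 1" "\<forall>g j. (shift_sum ^^ (l - b)) ((diff_fun ^^ min l b) g) j = (\<Sum>i\<le>l. c i * g (j + i))"
      using monic_operator_corner[of l b] unfolding monic_operator_def by blast
    hence "c l = 1 \<and> (\<forall>g. corner b l g = (\<Sum>i\<le>l. c i * g i))" unfolding corner_def by simp
    thus ?thesis by blast
  qed
  then obtain c where c: "\<And>l. c l l = 1" "\<And>l g. corner b l g = (\<Sum>i\<le>l. c l i * g i)" by metis
  let ?C = "\<lambda>i l. if i \<le> l then c l i else 0"
  have "fdet n g = fdet n g * fdet n ?C"
    by (subst (2) fdet_upper_triangular) (simp_all add: c(1))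
  also have "\<dots> = fdet n (\<lambda>k l. corner b l (g k))"
    unfolding fdet_mult
  proof (rule fdet_cong)
    fix k l assume "l < n"
    have "(\<Sum>i<n. g k i * ?C i l) = (\<Sum>i\<le>l. g k i * ?C i l)"
      by (rule sum.mono_neutral_right) (use \<open>l < n\<close> in auto)
    also have "\<dots> = corner b l (g k)" unfolding c(2) by (intro sum.cong) auto
    finally show "(\<Sum>i<n. g k i * ?C i l) = corner b l (g k)" .
  qed
  finally show ?thesis ..
qed

text \<open>Reversing the columns makes the matrix upper triangular. The reversal squares to the
  identity, so its determinant has absolute value 1 and its sign need not be found.\<close>

lemma abs_fdet_antitriangular:
  assumes "\<And>k l. k < n \<Longrightarrow> l < n \<Longrightarrow> n \<le> k + l \<Longrightarrow> B k l = 0"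
  shows "\<bar>fdet n B\<bar> = (\<Prod>k<n. \<bar>B k (n - 1 - k)\<bar>)"
proof -
  let ?J = "\<lambda>i j. if i = n - 1 - j then 1 else 0 :: real"
  have mult: "fdet n A * fdet n ?J = fdet n (\<lambda>k j. A k (n - 1 - j))" for A
    unfolding fdet_mult
  proof (rule fdet_cong)
    fix k j assume "j < n"
    have "(\<Sum>l<n. A k l * ?J l j) = (\<Sum>l<n. if l = n - 1 - j then A k l else 0)"
      by (intro sum.cong) auto
    also have "\<dots> = A k (n - 1 - j)" using \<open>j < n\<close> by (simp add: sum.delta)
    finally show "(\<Sum>l<n. A k l * ?J l j) = A k (n - 1 - j)" .
  qed
  have "fdet n ?J * fdet n ?J = fdet n (\<lambda>i j. if i = n - 1 - (n - 1 - j) then 1 else 0)"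
    by (rule mult)
  also have "\<dots> = (\<Prod>i<n. 1)"
    by (subst fdet_upper_triangular) auto
  finally have "(fdet n ?J)\<^sup>2 = 1" by (simp add: power2_eq_square)
  hence "\<bar>fdet n ?J\<bar> = 1" by (simp only: abs_square_eq_1)
  hence "\<bar>fdet n B\<bar> = \<bar>fdet n B * fdet n ?J\<bar>" by (simp add: abs_mult)
  also have "\<dots> = \<bar>\<Prod>k<n. B k (n - 1 - k)\<bar>"
    unfolding mult by (subst fdet_upper_triangular) (auto intro!: assms)
  finally show ?thesis by (simp add: abs_prod)
qed

text \<open>The \<open>b\<close> differences undo the \<open>b\<close> summations. The released
  shift sums, the outer one and the \<open>l - b\<close> in \<open>corner\<close> amount to
  \<open>Suc l\<close>.\<close>

lemma corner_left:
  assumes "k < a" "b \<le> l"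
  shows "corner b l (shift_sum (push a g b k)) = (-1) ^ b * (shift_sum ^^ Suc l) (g k) 0"
proof -
  have "(diff_fun ^^ b) (shift_sum (push a g b k)) = (\<lambda>j. (-1) ^ b * (shift_sum ^^ Suc b) (g k) j)"
    using funpow_diff_fun_neg_sum_shift[of b 1 0 "g k"] assms by (simp add: push_left)
  hence "corner b l (shift_sum (push a g b k)) =
    (-1) ^ b * (shift_sum ^^ (l - b)) ((shift_sum ^^ Suc b) (g k)) 0"
    using assms by (simp only: corner_def min_absorb2 funpow_shift_sum_scale)
  also have "(shift_sum ^^ (l - b)) ((shift_sum ^^ Suc b) (g k)) = (shift_sum ^^ (l - b + Suc b)) (g k)"
    by (simp only: funpow_add o_apply)
  also have "l - b + Suc b = Suc l" using assms by simp
  finally show ?thesis .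
qed

lemma funpow_shift_sum_const: "(shift_sum ^^ m) (\<lambda>_. x) = (\<lambda>_. 2 ^ m * x)"
  by (induction m) (simp_all add: shift_sum_def fun_eq_iff)

lemma funpow_diff_fun_const: "(diff_fun ^^ Suc m) (\<lambda>_. x) = (\<lambda>_. 0)"
  by (induction m) (simp_all add: diff_fun_def fun_eq_iff)

text \<open>After \<open>c\<close> differences the row is constant, so any further difference
  annihilates it.\<close>

lemma corner_new:
  assumes "c \<le> l" "b = Suc (c + i)"
  shows "corner b l (shift_sum (push a g b (a + i))) = (if l = c then (-1) ^ c * 2 ^ Suc c else 0)"
proof -
  let ?h = "shift_sum (push a g b (a + i))"
  have diff: "(diff_fun ^^ c) ?h = (\<lambda>_. (-1) ^ c * 2 ^ Suc c)"
    using funpow_diff_fun_neg_sum_shift[of c 1 0 "\<lambda>_. 1"] assms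
    by (simp add: push_new funpow_shift_sum_const shift_sum_def del: push.simps)
  show ?thesis
  proof (cases "l = c")
    case True
    thus ?thesis using assms diff by (simp add: corner_def)
  next
    case False
    then obtain r where r: "min l b = Suc r + c" using assms
      by (metis add.commute add_Suc_right le_add_diff_inverse less_iff_Suc_add le_neq_implies_less min_less_iff_conj not_add_less1 add_lessD1)
    have "(diff_fun ^^ min l b) ?h = (\<lambda>_. 0)"
      unfolding r funpow_add o_apply diff by (rule funpow_diff_fun_const)
    thus ?thesis using False by (simp add: corner_def funpow_shift_sum_const)
  qed
qed

lemma M_elbow_prod:
  assumes "a + b = n"
  shows "real (M (elbow n a b)) = (\<Prod>k<n. 2 ^ (n - k)) *
    (\<Prod>k<a. real (2 * n choose (n - k - 1)) / real (2 * n choose k))"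
proof -
  let ?G = "\<lambda>k. shift_sum (push a (\<lambda>k. kernel_fun n k n) b k)"
  let ?B = "\<lambda>k l. corner b l (?G k)"
  let ?r = "\<lambda>k. real (2 * n choose (n - k - 1)) / real (2 * n choose k)"
  \<comment> \<open>Beyond the antidiagonal, old rows vanish by the order of vanishing at -1, and
    new rows because they are differenced once too often.\<close>
  have zero: "?B k l = 0" if "k < n" "l < n" "n \<le> k + l" for k l
  proof (cases "k < a")
    case True
    hence "(shift_sum ^^ Suc l) (kernel_fun n k n) 0 = 0"
      using that by (intro shift_sum_kernel_fun_vanish) auto
    moreover have "b \<le> l" using True assms that by simp
    ultimately show ?thesis using True by (simp only: corner_left mult_zero_right)
  next
    case False
    then obtain i where i: "k = a + i" using le_Suc_ex not_less by blast
    define c where "c = n - 1 - k"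
    have c: "b = Suc (c + i)" "c < l" using that assms i by (auto simp: c_def)
    show ?thesis unfolding i by (subst corner_new[of c]) (use c in simp_all)
  qed
  have diag: "\<bar>?B k (n - 1 - k)\<bar> = 2 ^ (n - k) * (if k < a then ?r k else 1)" if "k < n" for k
  proof (cases "k < a")
    case True
    have "b \<le> n - 1 - k" "Suc (n - 1 - k) = n - k" using True assms by auto
    thus ?thesis using True that
      by (simp only: corner_left abs_mult power_abs abs_minus_cancel abs_one power_one mult_1_left
          shift_sum_kernel_fun_corner if_True)
  next
    case False
    then obtain i where i: "k = a + i" using le_Suc_ex not_less by blast
    define c where "c = n - 1 - k"
    have c: "b = Suc (c + i)" "n - k = Suc c" using that assms i by (auto simp: c_def)
    have "?B k c = (-1) ^ c * 2 ^ Suc c"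
      unfolding i by (subst corner_new[of c]) (use c in simp_all)
    thus ?thesis using False by (simp only: c_def[symmetric] c(2) abs_mult power_abs) simp
  qed
  have "real (M (elbow n a b)) = fdet n ?B"
    using left_kernel.M_elbow_fdet[OF kernel_fun_left_kernel assms] assms
    by (simp add: fdet_corner)
  \<comment> \<open>A tiling count is nonnegative, so no sign has to be tracked.\<close>
  hence "real (M (elbow n a b)) = \<bar>fdet n ?B\<bar>" by (metis abs_of_nat)
  also have "\<dots> = (\<Prod>k<n. \<bar>?B k (n - 1 - k)\<bar>)"
    by (rule abs_fdet_antitriangular) (rule zero)
  also have "\<dots> = (\<Prod>k<n. 2 ^ (n - k) * (if k < a then ?r k else 1))"
    by (rule prod.cong) (simp_all only: diag lessThan_iff)
  also have "\<dots> = (\<Prod>k<n. 2 ^ (n - k)) * (\<Prod>k<n. if k < a then ?r k else 1)"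
    by (rule prod.distrib)
  also have "(\<Prod>k<n. if k < a then ?r k else 1) = (\<Prod>k<a. ?r k)"
    by (rule prod.mono_neutral_cong_right) (use assms in auto)
  finally show ?thesis .
qed

section \<open>Closed form of the product\<close>

lemma H_Suc: "H (Suc k) = H k * fact k"
  by (simp add: H_def mult.commute)

lemma H_pos: "real (H k) > 0"
  by (simp add: H_def prod_pos)

text \<open>Induction on \<open>a\<close> with \<open>n\<close> fixed, so that \<open>b\<close>
  drops by one in each step; since \<open>n - a - 1 = b\<close>, the new factor consists of exactly
  the factorials by which the \<open>H\<close> terms change.\<close>

lemma binomial_ratio_prod:
  assumes "a + b = n"
  shows "(\<Prod>k<a. real (2 * n choose (n - k - 1)) / real (2 * n choose k)) =
    fact n * real (H (2 * n + 1)) * real (H a) * real (H b) / (real (H (n + a + 1)) * real (H (n + b + 1)))"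
  using assms
proof (induction a arbitrary: b)
  case 0
  have "real (H n) \<noteq> 0" "real (H (n + n)) \<noteq> 0" using H_pos by (metis less_irrefl)+
  thus ?case using 0 by (simp add: H_Suc mult_2 H_def[of 0])
next
  case (Suc a)
  have ix: "n - a - 1 = b" "2 * n - b = n + a + 1" "2 * n - a = n + b + 1" "b \<le> 2 * n" "a \<le> 2 * n"
    using Suc.prems by auto
  have r1: "real (2 * n choose (n - a - 1)) = fact (2 * n) / (fact b * fact (n + a + 1))"
    using binomial_fact[OF ix(4), where 'a = real] unfolding ix(1,2) .
  have r2: "real (2 * n choose a) = fact (2 * n) / (fact a * fact (n + b + 1))"
    using binomial_fact[OF ix(5), where 'a = real] unfolding ix(3) .
  have IH: "(\<Prod>k<a. real (2 * n choose (n - k - 1)) / real (2 * n choose k)) =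
    fact n * real (H (2 * n + 1)) * real (H a) * real (H (Suc b)) /
      (real (H (n + a + 1)) * real (H (n + Suc b + 1)))"
    by (rule Suc.IH) (use Suc.prems in simp)
  have H_Suc': "real (H (Suc k)) = real (H k) * fact k" for k
    by (simp add: H_Suc)
  have ix': "n + Suc b + 1 = Suc (n + b + 1)" "n + Suc a + 1 = Suc (n + a + 1)" by simp_all
  have alg: "f * h2 * ha * (hb * fb) / (hna * (hnb * fnb)) * (f2 / (fb * fna) / (f2 / (fa * fnb))) =
    f * h2 * (ha * fa) * hb / (hna * fna * hnb)"
    if "f2 \<noteq> 0" "fb \<noteq> 0" "fnb \<noteq> 0"
    for f h2 ha hb fb hna hnb fnb f2 fna fa :: real
    using that by (simp add: field_simps)
  show ?case
    unfolding prod.lessThan_Suc IH r1 r2 ix' H_Suc'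
    by (rule alg) (rule fact_nonzero)+
qed

lemma prod_power_of_two: "(\<Prod>k<n. 2 ^ (n - k)) = (2 :: real) ^ (n * (n + 1) div 2)"
proof -
  have "(\<Sum>k<n. n - k) = n * (n + 1) div 2"
  proof -
    have "(\<Sum>k<n. n - k) = (\<Sum>k<n. Suc k)"
      by (rule sum.reindex_bij_witness[of _ "\<lambda>k. n - Suc k" "\<lambda>k. n - Suc k"]) auto
    also have "\<dots> = n * (n + 1) div 2"
      by (induction n) auto
    finally show ?thesis .
  qed
  thus ?thesis by (simp flip: power_sum)
qed

theorem theorem2p2:
  fixes n a b :: nat
  assumes "\<exists>T. domino_tiling (elbow n a b) T"
  shows "real (M (elbow n a b)) =
    2 ^ (n * (n + 1) div 2) * fact n * real (H (2 * n + 1)) * real (H a) * real (H b)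
      / (real (H (n + a + 1)) * real (H (n + b + 1)))"
proof -
  from assms obtain T where "domino_tiling (elbow n a b) T" ..
  hence "a + b = n" by (rule elbow_balanced)
  thus ?thesis
    by (simp only: M_elbow_prod binomial_ratio_prod prod_power_of_two times_divide_eq_right mult.assoc)
qed

end
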